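(* Let $(r_i)$ be a computable sequence of non-negative rational numbers with convergent sum $\alpha=\sum_i r_i$, let $a_i=r_0+\dots+r_{i-1}$, and let $N(\varepsilon)$ be the modulus of convergence of $(a_i)$. Then the following are equivalent: (a) the series $\sum_i r_i$ has the Solovay property, i.e. there is $\varepsilon>0$ with $r_i\ge\varepsilon\, m_i$ for infinitely many $i$; (b) $\alpha$ is Martin-Löf random; (c) there is a constant $c$ such that $N(2^{-k})>BP(k-c)$ for all natural numbers $k$.
   Context: For a sequence $a_n\to\alpha$, the modulus of convergence $N(\varepsilon)$ is the minimal $N$ such that $|\alpha-a_n|<\varepsilon$ for all $n>N$. $\mathrm{KP}(n)$ denotes prefix (Kolmogorov) complexity of $n$. For an integer $k$, $BP(k)$ is the minimal $N$ such that $\mathrm{KP}(n)>k$ for all $n>N$ (i.e. the largest $n$ with $\mathrm{KP}(n)\le k$). $m_i$ denotes the a priori probability of $i$: a fixed universal lower semicomputable semimeasure on $\mathbb{N}$ (a uniformly lower semicomputable $m:\mathbb{N}\to[0,\infty)$ with $\sum_i m(i)\le1$ that dominates every such function up to a multiplicative constant). *)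

theory Defs
  imports "HOL-Analysis.Analysis" "HOL-Library.Sublist"
begin

section \<open>Partial recursive functions\<close>

datatype recf =
    Zero
  | Succ
  | Proj nat
  | Comp recf "recf list"
  | PrimRec recf recf
  | Minim recf

text \<open>
  \<open>computes f xs y\<close>: the program \<open>f\<close> halts on the argument list \<open>xs\<close> with result \<open>y\<close>.
  Programs carry no arity; on argument lists of any fixed length they compute exactly the
  partial recursive functions of that arity.
\<close>

inductive computes :: "recf \<Rightarrow> nat list \<Rightarrow> nat \<Rightarrow> bool" where
  zero: "computes Zero xs 0"
| succ: "computes Succ (x # xs) (Suc x)"
| proj: "i < length xs \<Longrightarrow> computes (Proj i) xs (xs ! i)"
| comp: "list_all2 (\<lambda>g y. computes g xs y) gs ys \<Longrightarrow> computes f ys z \<Longrightarrow>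
           computes (Comp f gs) xs z"
| prim_0: "computes f xs y \<Longrightarrow> computes (PrimRec f g) (0 # xs) y"
| prim_Suc: "computes (PrimRec f g) (n # xs) y \<Longrightarrow> computes g (n # y # xs) z \<Longrightarrow>
           computes (PrimRec f g) (Suc n # xs) z"
| minim: "computes f (n # xs) 0 \<Longrightarrow> (\<forall>i<n. \<exists>y. computes f (i # xs) (Suc y)) \<Longrightarrow>
           computes (Minim f) xs n"

definition computable :: "nat \<Rightarrow> (nat list \<Rightarrow> nat) \<Rightarrow> bool" where
  "computable k f \<longleftrightarrow> (\<exists>e. \<forall>xs. length xs = k \<longrightarrow> computes e xs (f xs))"

definition computable_rat :: "nat \<Rightarrow> (nat list \<Rightarrow> rat) \<Rightarrow> bool" where
  "computable_rat k q \<longleftrightarrow>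
     (\<exists>a b d. computable k a \<and> computable k b \<and> computable k d \<and>
        (\<forall>xs. length xs = k \<longrightarrow>
           d xs > 0 \<and> q xs = (of_nat (a xs) - of_nat (b xs)) / of_nat (d xs)))"

abbreviation computable_rat_seq :: "(nat \<Rightarrow> rat) \<Rightarrow> bool" where
  "computable_rat_seq q \<equiv> computable_rat 1 (\<lambda>xs. q (xs ! 0))"

abbreviation computable_rat_seq2 :: "(nat \<Rightarrow> nat \<Rightarrow> rat) \<Rightarrow> bool" where
  "computable_rat_seq2 q \<equiv> computable_rat 2 (\<lambda>xs. q (xs ! 0) (xs ! 1))"


section \<open>A priori probability\<close>

text \<open>Uniformly in \<open>i\<close>, the value \<open>m i\<close> is approximated from below by rationals.\<close>

definition lower_semicomputable :: "(nat \<Rightarrow> real) \<Rightarrow> bool" where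
  "lower_semicomputable m \<longleftrightarrow>
     (\<exists>q. computable_rat_seq2 q \<and>
        (\<forall>i. incseq (q i) \<and> (\<lambda>s. real_of_rat (q i s)) \<longlonglongrightarrow> m i))"

definition semimeasure :: "(nat \<Rightarrow> real) \<Rightarrow> bool" where
  "semimeasure m \<longleftrightarrow> (\<forall>i. 0 \<le> m i) \<and> summable m \<and> (\<Sum>i. m i) \<le> 1"

definition universal_semimeasure :: "(nat \<Rightarrow> real) \<Rightarrow> bool" where
  "universal_semimeasure m \<longleftrightarrow>
     semimeasure m \<and> lower_semicomputable m \<and>
     (\<forall>m'. semimeasure m' \<and> lower_semicomputable m' \<longrightarrow> (\<exists>C>0. \<forall>i. m' i \<le> C * m i))"

definition solovay_property :: "(nat \<Rightarrow> real) \<Rightarrow> (nat \<Rightarrow> rat) \<Rightarrow> bool" where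
  "solovay_property m r \<longleftrightarrow> (\<exists>\<epsilon>>0. infinite {i. real_of_rat (r i) \<ge> \<epsilon> * m i})"


section \<open>Prefix complexity\<close>

text \<open>The string \<open>p\<close> is coded by the number with binary notation \<open>1p\<close>.\<close>

definition bits_code :: "bool list \<Rightarrow> nat" where
  "bits_code p = fold (\<lambda>b n. 2 * n + of_bool b) p 1"

definition prefix_free_machine :: "(bool list \<Rightarrow> nat option) \<Rightarrow> bool" where
  "prefix_free_machine U \<longleftrightarrow>
     (\<exists>e. \<forall>p n. U p = Some n \<longleftrightarrow> computes e [bits_code p] n) \<and>
     (\<forall>p\<in>dom U. \<forall>q\<in>dom U. prefix p q \<longrightarrow> p = q)"

definition optimal_machine :: "(bool list \<Rightarrow> nat option) \<Rightarrow> bool" where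
  "optimal_machine U \<longleftrightarrow>
     prefix_free_machine U \<and>
     (\<forall>V. prefix_free_machine V \<longrightarrow>
        (\<exists>c. \<forall>p n. V p = Some n \<longrightarrow> (\<exists>q. U q = Some n \<and> length q \<le> length p + c)))"

definition KP :: "(bool list \<Rightarrow> nat option) \<Rightarrow> nat \<Rightarrow> nat" where
  "KP U n = (LEAST l. \<exists>p. length p = l \<and> U p = Some n)"

text \<open>
  \<open>BP U k\<close> is the largest \<open>n\<close> with \<open>KP U n \<le> k\<close>, and \<open>-1\<close> if there is none (for instance,
  for every negative \<open>k\<close>). With the value \<open>0\<close> in the latter case, a bound of the form
  \<open>N (2 ^ -k) > BP (k - c)\<close> would fail at \<open>k = 0\<close>, whatever \<open>c\<close>, for every series with sum
  below \<open>1\<close>, since then \<open>N 1 = 0\<close>.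
\<close>

definition BP :: "(bool list \<Rightarrow> nat option) \<Rightarrow> int \<Rightarrow> int" where
  "BP U k = (LEAST N. N \<ge> -1 \<and> (\<forall>n. int n > N \<longrightarrow> int (KP U n) > k))"


section \<open>Modulus of convergence\<close>

definition modulus :: "(nat \<Rightarrow> real) \<Rightarrow> real \<Rightarrow> real \<Rightarrow> nat" where
  "modulus a \<alpha> \<epsilon> = (LEAST N. \<forall>n>N. \<bar>\<alpha> - a n\<bar> < \<epsilon>)"


section \<open>Martin-Loef randomness\<close>

text \<open>Uniformly effectively open sets of reals (intervals with \<open>a n k \<ge> b n k\<close> are empty).\<close>

definition uniformly_effectively_open :: "(nat \<Rightarrow> real set) \<Rightarrow> bool" where
  "uniformly_effectively_open G \<longleftrightarrow>
     (\<exists>a b. computable_rat_seq2 a \<and> computable_rat_seq2 b \<and>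
        (\<forall>n. G n = (\<Union>k. {real_of_rat (a n k)<..<real_of_rat (b n k)})))"

definition martin_loef_test :: "(nat \<Rightarrow> real set) \<Rightarrow> bool" where
  "martin_loef_test G \<longleftrightarrow>
     uniformly_effectively_open G \<and> (\<forall>n. emeasure lborel (G n) \<le> ennreal ((1/2) ^ n))"

definition martin_loef_random :: "real \<Rightarrow> bool" where
  "martin_loef_random \<alpha> \<longleftrightarrow> (\<forall>G. martin_loef_test G \<longrightarrow> \<alpha> \<notin> (\<Inter>n. G n))"

end

theory Submission
  imports Defs
begin

text \<open>
  The three properties imply each other in a cycle.

  Solovay property implies randomness: if \<open>\<alpha>\<close> lies in all sets \<open>G n\<close> of a test, then
  \<open>m' i = (\<Sum>c. 2 ^ c * length ([a i, a (i + 1)) \<inter> G (2 * c + 1)))\<close> is a lower semicomputable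
  semimeasure, and \<open>m' i \<ge> 2 ^ c * r i\<close> for every \<open>c\<close> and almost all \<open>i\<close>, since eventually
  the interval lies in \<open>G (2 * c + 1)\<close>.

  Randomness implies fast growth of the modulus: a program \<open>p\<close> with output \<open>n\<close> covers the
  neighbourhood of \<open>a (n + 1)\<close> of radius \<open>2 ^ -(length p + c + 1)\<close>. By Kraft's inequality these
  intervals form a test, and it captures \<open>\<alpha>\<close> if the modulus grows too slowly.

  Fast growth implies the Solovay property: otherwise \<open>r i < \<epsilon> * m i\<close> for almost all \<open>i\<close>. Let
  \<open>M t\<close> increase to the sum of \<open>m\<close>, and let a pointer move by \<open>\<epsilon>\<close> times the increments of
  \<open>M\<close> and jump to \<open>a t\<close> whenever it falls behind. It passes \<open>\<alpha>\<close> eventually, in a step of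
  length \<open>\<epsilon> * \<delta>\<close>. Granting, for each step, the weight \<open>\<delta> * sqrt \<epsilon>\<close> to some \<open>n\<close> for which
  \<open>a n\<close> is within \<open>\<epsilon> * \<delta>\<close> of the start of the step yields an \<open>n\<close> of small complexity beyond
  the modulus.
\<close>

section \<open>Determinism of programs\<close>

lemma computes_functional:
  "computes e xs y \<Longrightarrow> computes e xs z \<Longrightarrow> z = y"
proof (induction arbitrary: z rule: computes.induct)
  case (zero xs)
  then show ?case by cases auto
next
  case (succ x xs)
  then show ?case by cases auto
next
  case (proj i xs)
  from proj(2) show ?case by cases auto
next
  case (comp xs gs ys f w)
  from comp.prems obtain ys' where ys': "list_all2 (\<lambda>g y. computes g xs y) gs ys'" "computes f ys' z"
    by cases auto
  have "ys' = ys"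
    using comp.IH(1) ys'(1) by (auto simp: list_all2_conv_all_nth intro: nth_equalityI)
  with ys'(2) comp.IH(2) show ?case by simp
next
  case (prim_0 f xs y g)
  from prim_0.prems show ?case by cases (auto dest: prim_0.IH)
next
  case (prim_Suc f g n xs y w)
  from prim_Suc.prems obtain y' where "computes (PrimRec f g) (n # xs) y'" "computes g (n # y' # xs) z"
    by cases auto
  with prim_Suc.IH show ?case by metis
next
  case (minim f n xs)
  from minim.prems show ?case
  proof cases
    case minim': minim
    have "\<not> z < n"
    proof
      assume "z < n"
      then obtain v where "computes f (z # xs) (Suc v)" "\<forall>u. computes f (z # xs) u \<longrightarrow> u = Suc v"
        using minim.IH(2) by blast
      with minim'(1) show False by auto
    qed
    moreover have "\<not> n < z"
    proof
      assume "n < z"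
      with minim'(2) obtain v where "computes f (n # xs) (Suc v)" by blast
      with minim.IH(1) have "Suc v = 0" by blast
      then show False by simp
    qed
    ultimately show ?thesis by simp
  qed
qed

section \<open>Recursive functions of one number\<close>

definition recursive :: "(nat \<Rightarrow> nat) \<Rightarrow> bool" where
  "recursive f \<longleftrightarrow> (\<exists>e. \<forall>x. computes e [x] (f x))"

lemma computes_comp1:
  "computes g xs y \<Longrightarrow> computes f [y] z \<Longrightarrow> computes (Comp f [g]) xs z"
  by (rule computes.comp[where ys = "[y]"]) auto

lemma computes_comp2:
  "computes g xs y \<Longrightarrow> computes g' xs y' \<Longrightarrow> computes f [y, y'] z \<Longrightarrow> computes (Comp f [g, g']) xs z"
  by (rule computes.comp[where ys = "[y, y']"]) auto

lemma computes_proj: "i < length xs \<Longrightarrow> y = xs ! i \<Longrightarrow> computes (Proj i) xs y"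
  using computes.proj by simp

lemma computes_succ: "computes Succ [x] (Suc x)"
  by (rule computes.succ)

section \<open>Programs for arithmetic and Cantor pairing\<close>

definition add_recf :: recf where
  "add_recf = PrimRec (Proj 0) (Comp Succ [Proj 1])"

lemma computes_add: "computes add_recf [n, x] (n + x)"
  unfolding add_recf_def
proof (induction n)
  case 0
  show ?case by (rule computes.prim_0) (simp add: computes_proj)
next
  case (Suc n)
  show ?case
    by (rule computes.prim_Suc[OF Suc])
      (use computes_succ in \<open>auto intro!: computes_comp1 computes_proj\<close>)
qed

definition pred_recf :: recf where
  "pred_recf = PrimRec Zero (Proj 0)"

lemma computes_pred: "computes pred_recf [n] (n - 1)"
  unfolding pred_recf_def
proof (induction n)
  case 0
  show ?case by (rule computes.prim_0) (simp add: computes.zero)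
next
  case (Suc n)
  show ?case by (rule computes.prim_Suc[OF Suc]) (simp add: computes_proj)
qed

text \<open>Recursion runs on the first argument, so the subtrahend comes first.\<close>

definition monus_recf :: recf where
  "monus_recf = PrimRec (Proj 0) (Comp pred_recf [Proj 1])"

lemma computes_monus: "computes monus_recf [n, x] (x - n)"
  unfolding monus_recf_def
proof (induction n)
  case 0
  show ?case by (rule computes.prim_0) (simp add: computes_proj)
next
  case (Suc n)
  show ?case
    by (rule computes.prim_Suc[OF Suc])
      (use computes_pred[of "x - n"] in \<open>auto intro!: computes_comp1 computes_proj\<close>)
qed

definition triangle_recf :: recf where
  "triangle_recf = PrimRec Zero (Comp add_recf [Comp Succ [Proj 0], Proj 1])"

lemma computes_triangle: "computes triangle_recf [n] (triangle n)"
  unfolding triangle_recf_def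
proof (induction n)
  case 0
  show ?case by (rule computes.prim_0) (simp add: computes.zero)
next
  case (Suc n)
  have "computes add_recf [Suc n, triangle n] (triangle (Suc n))"
    using computes_add[of "Suc n" "triangle n"] by (simp add: add.commute)
  then show ?case
    by (intro computes.prim_Suc[OF Suc] computes_comp2[of "Comp Succ [Proj 0]" _ "Suc n" "Proj 1" "triangle n"]
      computes_comp1[OF _ computes_succ])
      (simp_all add: computes_proj)
qed

lemma computes_prod_encode:
  "computes (Comp add_recf [Comp triangle_recf [add_recf], Proj 0]) [m, n] (prod_encode (m, n))"
  unfolding prod_encode_def prod.case
  by (intro computes_comp2[OF computes_comp1[OF computes_add computes_triangle] _ computes_add])
    (simp add: computes_proj)

text \<open>A pair \<open>(m, n)\<close> lies on the diagonal \<open>m + n\<close>, and its code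
  \<open>x\<close> lies between the triangular numbers of \<open>m + n\<close> and
  \<open>m + n + 1\<close>. The search finds the diagonal as the least \<open>k\<close> with
  \<open>Suc x - triangle (Suc k) = 0\<close>.\<close>

definition triangle_root_recf :: recf where
  "triangle_root_recf = Minim (Comp monus_recf [Comp triangle_recf [Comp Succ [Proj 0]], Comp Succ [Proj 1]])"

lemma computes_triangle_root:
  "computes triangle_root_recf [prod_encode (m, n)] (m + n)"
proof -
  let ?f = "Comp monus_recf [Comp triangle_recf [Comp Succ [Proj 0]], Comp Succ [Proj 1]]"
  have f: "computes ?f [k, x] (Suc x - triangle (Suc k))" for k x
    by (intro computes_comp2[OF computes_comp1[OF computes_comp1[OF _ computes_succ] computes_triangle]
          computes_comp1[OF _ computes_succ] computes_monus]) (simp_all add: computes_proj)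
  have 0: "computes ?f [m + n, prod_encode (m, n)] 0"
    using f[of "m + n" "prod_encode (m, n)"] by (simp add: prod_encode_def)
  have "\<exists>y. computes ?f [i, prod_encode (m, n)] (Suc y)" if "i < m + n" for i
  proof -
    have "mono triangle" by (intro incseq_SucI) simp
    then have "triangle (Suc i) \<le> triangle (m + n)" 
      using that by (simp only: monoD Suc_leI)
    then have "Suc (prod_encode (m, n)) - triangle (Suc i) = Suc (prod_encode (m, n) - triangle (Suc i))"
      by (auto simp: prod_encode_def)
    then show ?thesis using f[of i "prod_encode (m, n)"] by metis
  qed
  with 0 show ?thesis unfolding triangle_root_recf_def by (auto intro!: computes.minim)
qed

abbreviation fst_nat :: "nat \<Rightarrow> nat" where "fst_nat n \<equiv> fst (prod_decode n)"
abbreviation snd_nat :: "nat \<Rightarrow> nat" where "snd_nat n \<equiv> snd (prod_decode n)"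

definition fst_recf :: recf where
  "fst_recf = Comp monus_recf [Comp triangle_recf [triangle_root_recf], Proj 0]"

definition snd_recf :: recf where
  "snd_recf = Comp monus_recf [fst_recf, triangle_root_recf]"

lemma computes_fst: "computes fst_recf [x] (fst_nat x)"
proof -
  obtain m n where x: "x = prod_encode (m, n)" by (metis prod_decode_inverse surj_pair)
  have "computes fst_recf [x] (x - triangle (m + n))"
    unfolding fst_recf_def x
    by (rule computes_comp2[OF computes_comp1[OF computes_triangle_root computes_triangle] _ computes_monus])
      (simp add: computes_proj)
  then show ?thesis by (simp add: x) (simp add: prod_encode_def)
qed

lemma computes_snd: "computes snd_recf [x] (snd_nat x)"
proof -
  obtain m n where x: "x = prod_encode (m, n)" by (metis prod_decode_inverse surj_pair)
  have "computes snd_recf [x] (m + n - fst_nat x)"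
    unfolding snd_recf_def
    by (rule computes_comp2[OF computes_fst _ computes_monus]) (auto simp: x computes_triangle_root)
  then show ?thesis by (simp add: x)
qed

section \<open>Closure properties of recursive functions\<close>

lemma recursive_comp: "recursive f \<Longrightarrow> recursive g \<Longrightarrow> recursive (\<lambda>x. f (g x))"
  unfolding recursive_def using computes_comp1 by blast

lemma recursive_id: "recursive (\<lambda>x. x)"
  unfolding recursive_def by (rule exI[of _ "Proj 0"]) (auto intro!: computes_proj)

lemma recursive_Suc: "recursive Suc"
  unfolding recursive_def using computes_succ by blast

lemma recursive_const: "recursive (\<lambda>x. c)"
proof (induction c)
  case 0
  show ?case unfolding recursive_def using computes.zero by blast
next
  case (Suc c)
  then show ?case using recursive_comp[OF recursive_Suc] by blast
qed

lemma recursive_fst: "recursive fst_nat" 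
  unfolding recursive_def using computes_fst by blast

lemma recursive_snd: "recursive snd_nat" 
  unfolding recursive_def using computes_snd by blast

lemma recursive_pair:
  "recursive f \<Longrightarrow> recursive g \<Longrightarrow> recursive (\<lambda>x. prod_encode (f x, g x))"
  unfolding recursive_def using computes_comp2[OF _ _ computes_prod_encode] by blast

lemma recursive_add: "recursive f \<Longrightarrow> recursive g \<Longrightarrow> recursive (\<lambda>x. f x + g x)"
  unfolding recursive_def using computes_comp2[OF _ _ computes_add] by blast

lemma recursive_diff: "recursive f \<Longrightarrow> recursive g \<Longrightarrow> recursive (\<lambda>x. f x - g x)"
  unfolding recursive_def using computes_comp2[OF _ _ computes_monus] by blast

text \<open>Counter, accumulator and parameter are packed into one number, so that only unary
  functions have to be considered.\<close>

lemma recursive_rec: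
  assumes "recursive b" "recursive n" "recursive g"
  shows "recursive (\<lambda>x. rec_nat (b x) (\<lambda>i v. g (prod_encode (i, prod_encode (v, x)))) (n x))"
proof -
  obtain eb en eg where e: "\<And>x. computes eb [x] (b x)" "\<And>x. computes en [x] (n x)"
      "\<And>x. computes eg [x] (g x)"
    using assms unfolding recursive_def by blast
  let ?pair = "Comp add_recf [Comp triangle_recf [add_recf], Proj 0]"
  let ?g = "Comp eg [Comp ?pair [Proj 0, Comp ?pair [Proj 1, Proj 2]]]"
  have g: "computes ?g [i, v, x] (g (prod_encode (i, prod_encode (v, x))))" for i v x
    by (rule computes_comp1[OF computes_comp2[OF _ computes_comp2[OF _ _ computes_prod_encode] computes_prod_encode] e(3)])
      (auto intro!: computes_proj)
  have "computes (PrimRec eb ?g) [k, x] (rec_nat (b x) (\<lambda>i v. g (prod_encode (i, prod_encode (v, x)))) k)" for k x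
  proof (induction k)
    case 0
    show ?case using e(1) by (auto intro!: computes.prim_0)
  next
    case (Suc k)
    show ?case by (rule computes.prim_Suc[OF Suc]) (use g in auto)
  qed
  then have "computes (Comp (PrimRec eb ?g) [en, Proj 0]) [x]
      (rec_nat (b x) (\<lambda>i v. g (prod_encode (i, prod_encode (v, x)))) (n x))" for x
    by (intro computes_comp2[OF e(2)]) (auto intro!: computes_proj)
  then show ?thesis unfolding recursive_def by blast
qed

text \<open>This is the source of partial functions: the program diverges exactly when the search
  fails, as a machine must do outside its domain.\<close>

lemma minimization_recf:
  assumes "recursive g"
  shows "\<exists>e. \<forall>x n. computes e [x] n \<longleftrightarrow>
    (\<exists>i. g (prod_encode (i, x)) = 0) \<and> n = (LEAST i. g (prod_encode (i, x)) = 0)"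
proof -
  obtain eg where eg: "\<And>x. computes eg [x] (g x)"
    using assms unfolding recursive_def by blast
  let ?g = "Comp eg [Comp add_recf [Comp triangle_recf [add_recf], Proj 0]]"
  have g: "computes ?g [i, x] (g (prod_encode (i, x)))" for i x
    by (rule computes_comp1[OF computes_prod_encode eg])
  have least: "computes (Minim ?g) [x] (LEAST i. g (prod_encode (i, x)) = 0)"
    if ex: "\<exists>i. g (prod_encode (i, x)) = 0" for x
  proof (rule computes.minim)
    show "computes ?g [LEAST i. g (prod_encode (i, x)) = 0, x] 0"
      using g[of "LEAST i. g (prod_encode (i, x)) = 0" x] LeastI_ex[OF ex] by simp
    show "\<forall>i<LEAST i. g (prod_encode (i, x)) = 0. \<exists>y. computes ?g [i, x] (Suc y)"
    proof (intro allI impI)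
      fix i assume "i < (LEAST i. g (prod_encode (i, x)) = 0)"
      then obtain y where "g (prod_encode (i, x)) = Suc y"
        using not_less_Least[of i "\<lambda>i. g (prod_encode (i, x)) = 0"] not0_implies_Suc by blast
      then show "\<exists>y. computes ?g [i, x] (Suc y)" using g[of i x] by auto
    qed
  qed
  have "computes (Minim ?g) [x] n \<longleftrightarrow>
    (\<exists>i. g (prod_encode (i, x)) = 0) \<and> n = (LEAST i. g (prod_encode (i, x)) = 0)" for x n
  proof
    assume c: "computes (Minim ?g) [x] n"
    then have "computes ?g [n, x] 0" by cases auto
    then have "g (prod_encode (n, x)) = 0" using computes_functional g by blast
    then have "\<exists>i. g (prod_encode (i, x)) = 0" by blast
    with least c show "(\<exists>i. g (prod_encode (i, x)) = 0) \<and> n = (LEAST i. g (prod_encode (i, x)) = 0)"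
      using computes_functional by blast
  qed (use least in auto)
  then show ?thesis by blast
qed

lemma recursive_Least:
  assumes "recursive g" "\<And>x. \<exists>i. g (prod_encode (i, x)) = 0"
  shows "recursive (\<lambda>x. LEAST i. g (prod_encode (i, x)) = 0)"
  using minimization_recf[OF assms(1)] assms(2) unfolding recursive_def by metis

section \<open>Effective functions between numbered types\<close>

text \<open>An element may have several numbers, so fractions need not be reduced.\<close>

class numbered =
  fixes decode :: "nat \<Rightarrow> 'a"
  assumes surj_decode: "surj decode"

instantiation nat :: numbered
begin
definition "decode = (\<lambda>n::nat. n)"
instance by standard (simp add: decode_nat_def)
end

instantiation bool :: numbered
begin
definition "decode = (\<lambda>n. n \<noteq> (0::nat))"
instance
proof
  show "surj (decode :: nat \<Rightarrow> bool)"
    unfolding decode_bool_def surj_def by (metis zero_neq_one)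
qed
end

instantiation prod :: (numbered, numbered) numbered
begin
definition "decode = (\<lambda>n. (decode (fst_nat n), decode (snd_nat n)) :: 'a \<times> 'b)"
instance
proof
  have "\<exists>n. z = decode n" for z :: "'a \<times> 'b"
  proof -
    obtain m n where "fst z = decode m" "snd z = decode n"
      using surj_decode unfolding surj_def by metis
    then show ?thesis
      by (intro exI[of _ "prod_encode (m, n)"]) (simp add: decode_prod_def flip: \<open>fst z = _\<close> \<open>snd z = _\<close>)
  qed
  then show "surj (decode :: nat \<Rightarrow> 'a \<times> 'b)" by (simp add: surj_def)
qed
end

definition effective :: "('a::numbered \<Rightarrow> 'b::numbered) \<Rightarrow> bool" where
  "effective f \<longleftrightarrow> (\<exists>g. recursive g \<and> (\<forall>n. f (decode n) = decode (g n)))"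

lemma effectiveI: "recursive g \<Longrightarrow> (\<And>n. f (decode n) = decode (g n)) \<Longrightarrow> effective f"
  unfolding effective_def by blast

lemma effectiveE:
  assumes "effective f"
  obtains g where "recursive g" "\<And>n. f (decode n) = decode (g n)"
  using assms unfolding effective_def by blast

lemma effective_nat_iff: "effective f \<longleftrightarrow> recursive f" for f :: "nat \<Rightarrow> nat"
proof -
  have "f = g" if "\<And>n. f n = g n" for f g :: "nat \<Rightarrow> nat" using that by blast
  then show ?thesis unfolding effective_def decode_nat_def by metis
qed

named_theorems effective_intros

lemma effective_id [effective_intros]: "effective (\<lambda>x. x)"
  by (rule effectiveI[OF recursive_id]) simp

lemma effective_const [effective_intros]: "effective (\<lambda>x. c)"
proof -
  obtain n where "c = decode n" using surj_decode unfolding surj_def by metis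
  then show ?thesis by (intro effectiveI[OF recursive_const]) auto
qed

lemma effective_compose:
  assumes "effective f" "effective g"
  shows "effective (\<lambda>x. f (g x))"
proof -
  obtain f' where "recursive f'" "\<And>n. f (decode n) = decode (f' n)"
    using assms(1) by (rule effectiveE) (rule that, simp_all)
  moreover obtain g' where "recursive g'" "\<And>n. g (decode n) = decode (g' n)"
    using assms(2) by (rule effectiveE) (rule that, simp_all)
  ultimately show ?thesis using recursive_comp[of f' g'] by (auto intro!: effectiveI[where g = "\<lambda>n. f' (g' n)"])
qed

lemma effective_Pair [effective_intros]: "effective f \<Longrightarrow> effective g \<Longrightarrow> effective (\<lambda>x. (f x, g x))"
  by (elim effectiveE, rule effectiveI[OF recursive_pair]) (auto simp: decode_prod_def)

lemma effective_compose2: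
  "effective (\<lambda>z. f (fst z) (snd z)) \<Longrightarrow> effective g \<Longrightarrow> effective h \<Longrightarrow> effective (\<lambda>x. f (g x) (h x))"
  using effective_compose[of "\<lambda>z. f (fst z) (snd z)" "\<lambda>x. (g x, h x)"] effective_Pair[of g h] by simp

lemma effective_fst [effective_intros]: "effective f \<Longrightarrow> effective (\<lambda>x. fst (f x))"
  by (rule effective_compose[where f = fst])
    (auto intro!: effectiveI[OF recursive_fst] simp: decode_prod_def)

lemma effective_snd [effective_intros]: "effective f \<Longrightarrow> effective (\<lambda>x. snd (f x))"
  by (rule effective_compose[where f = snd])
    (auto intro!: effectiveI[OF recursive_snd] simp: decode_prod_def)

text \<open>All loops below reduce to this rule. The accumulator may have any numbered type, so sums
  of rationals and bounded quantifiers are instances.\<close>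

lemma effective_rec_nat [effective_intros]:
  fixes G :: "nat \<Rightarrow> 'b::numbered \<Rightarrow> 'a::numbered \<Rightarrow> 'b"
  assumes "effective b" "effective (\<lambda>z. G (fst z) (fst (snd z)) (snd (snd z)))" "effective n"
  shows "effective (\<lambda>x. rec_nat (b x) (\<lambda>i v. G i v x) (n x))"
proof -
  obtain b' where b: "recursive b'" and b': "\<And>k. b (decode k) = decode (b' k)"
    using assms(1) by (rule effectiveE) (rule that, simp_all)
  obtain g' where gr: "recursive g'"
    and g': "\<And>k. (\<lambda>z. G (fst z) (fst (snd z)) (snd (snd z))) (decode k) = decode (g' k)"
    using assms(2) by (rule effectiveE) (rule that, simp_all)
  obtain n' where nr: "recursive n'" and n': "\<And>k. n (decode k) = decode (n' k)"
    using assms(3) by (rule effectiveE) (rule that, simp_all)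
  have g: "G i (decode v) (decode x) = decode (g' (prod_encode (i, prod_encode (v, x))))" for i v x
    using g'[of "prod_encode (i, prod_encode (v, x))"] by (simp add: decode_prod_def decode_nat_def)
  have "rec_nat (b (decode x)) (\<lambda>i v. G i v (decode x)) m =
      decode (rec_nat (b' x) (\<lambda>i v. g' (prod_encode (i, prod_encode (v, x)))) m)" for x m
    by (induction m) (simp_all add: b' g)
  then show ?thesis
    by (intro effectiveI[OF recursive_rec[OF b nr gr]]) (simp add: n' decode_nat_def)
qed

subsection \<open>Numbers and truth values\<close>

lemma effective_natI: "recursive g \<Longrightarrow> effective g"
  by (simp add: effective_nat_iff)

lemma effective_add_nat [effective_intros]:
  fixes f g :: "'a::numbered \<Rightarrow> nat"
  shows "effective f \<Longrightarrow> effective g \<Longrightarrow> effective (\<lambda>x. f x + g x)"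
  by (elim effectiveE, rule effectiveI[OF recursive_add]) (auto simp: decode_nat_def)

lemma effective_diff_nat [effective_intros]:
  fixes f g :: "'a::numbered \<Rightarrow> nat"
  shows "effective f \<Longrightarrow> effective g \<Longrightarrow> effective (\<lambda>x. f x - g x)"
  by (elim effectiveE, rule effectiveI[OF recursive_diff]) (auto simp: decode_nat_def)

lemma effective_Suc [effective_intros]: "effective f \<Longrightarrow> effective (\<lambda>x. Suc (f x))"
  by (rule effective_compose[OF effective_natI[OF recursive_Suc]])

lemma effective_neq_0: "effective f \<Longrightarrow> effective (\<lambda>x. f x \<noteq> (0::nat))"
  by (elim effectiveE, rule effectiveI) (auto simp: decode_nat_def decode_bool_def)

lemma effective_of_bool: "effective f \<Longrightarrow> effective (\<lambda>x. of_bool (f x) :: nat)"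
proof (elim effectiveE)
  fix g assume "recursive g" "\<And>n. f (decode n) = decode (g n)"
  \<comment> \<open>Every nonzero number stands for truth; the double truncated subtraction
    normalizes it to 1.\<close>
  then show ?thesis
    by (intro effectiveI[where g = "\<lambda>n. 1 - (1 - g n)"] recursive_diff recursive_const)
      (auto simp: decode_nat_def decode_bool_def)
qed

lemma effective_If [effective_intros]:
  assumes "effective b" "effective f" "effective g"
  shows "effective (\<lambda>x. if b x then f x else g x)"
proof -
  \<comment> \<open>A recursion of length 0 or 1 selects the branch.\<close>
  have eq: "(if b x then f x else g x) = rec_nat (g x) (\<lambda>i v. f x) (of_bool (b x))" for x
    by simp
  show ?thesis unfolding eq
    by (intro effective_rec_nat effective_of_bool assms effective_compose[OF assms(2)] effective_intros)
qed

lemma effective_not [effective_intros]: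
  assumes "effective f"
  shows "effective (\<lambda>x. \<not> f x)"
proof -
  have eq: "(\<not> f x) = (if f x then False else True)" for x by simp
  show ?thesis unfolding eq by (intro effective_If effective_const assms)
qed

lemma effective_conj [effective_intros]:
  assumes "effective f" "effective g"
  shows "effective (\<lambda>x. f x \<and> g x)"
proof -
  have eq: "(f x \<and> g x) = (if f x then g x else False)" for x by simp
  show ?thesis unfolding eq by (intro effective_If effective_const assms)
qed

lemma effective_disj [effective_intros]:
  assumes "effective f" "effective g"
  shows "effective (\<lambda>x. f x \<or> g x)"
proof -
  have eq: "(f x \<or> g x) = (if f x then True else g x)" for x by simp
  show ?thesis unfolding eq by (intro effective_If effective_const assms)
qed

lemma effective_le_nat [effective_intros]:
  fixes f g :: "'a::numbered \<Rightarrow> nat"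
  assumes "effective f" "effective g"
  shows "effective (\<lambda>x. f x \<le> g x)"
  using effective_not[OF effective_neq_0[OF effective_diff_nat[OF assms]]] by simp

lemma effective_less_nat [effective_intros]:
  fixes f g :: "'a::numbered \<Rightarrow> nat"
  assumes "effective f" "effective g"
  shows "effective (\<lambda>x. f x < g x)"
  using effective_not[OF effective_le_nat[OF assms(2,1)]] by (simp add: not_le)

lemma effective_eq_nat [effective_intros]:
  fixes f g :: "'a::numbered \<Rightarrow> nat"
  assumes "effective f" "effective g"
  shows "effective (\<lambda>x. f x = g x)"
  using effective_conj[OF effective_le_nat[OF assms] effective_le_nat[OF assms(2,1)]]
  by (simp add: order_eq_iff)

lemma effective_mult_nat [effective_intros]:
  fixes f g :: "'a::numbered \<Rightarrow> nat"
  assumes "effective f" "effective g"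
  shows "effective (\<lambda>x. f x * g x)"
proof -
  have eq: "f x * g x = rec_nat 0 (\<lambda>i v. v + g x) (f x)" for x
  proof -
    have "n * g x = rec_nat 0 (\<lambda>i v. v + g x) n" for n by (induction n) auto
    then show ?thesis .
  qed
  show ?thesis unfolding eq
    by (intro effective_rec_nat effective_compose[OF assms(2)] assms(1) effective_intros)
qed

lemma effective_power_nat [effective_intros]:
  fixes f g :: "'a::numbered \<Rightarrow> nat"
  assumes "effective f" "effective g"
  shows "effective (\<lambda>x. f x ^ g x)"
proof -
  have eq: "f x ^ g x = rec_nat 1 (\<lambda>i v. v * f x) (g x)" for x
  proof -
    have "f x ^ n = rec_nat 1 (\<lambda>i v. v * f x) n" for n by (induction n) auto
    then show ?thesis .
  qed
  show ?thesis unfolding eq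
    by (intro effective_rec_nat effective_compose[OF assms(1)] assms(2) effective_intros)
qed

lemma effective_ex_less [effective_intros]:
  fixes n :: "'a::numbered \<Rightarrow> nat"
  assumes "effective n" "effective (\<lambda>z. P (fst z) (snd z))"
  shows "effective (\<lambda>x. \<exists>k<n x. P k x)"
proof -
  have eq: "(\<exists>k<n x. P k x) = rec_nat False (\<lambda>i v. P i x \<or> v) (n x)" for x
  proof -
    have "(\<exists>k<m. P k x) = rec_nat False (\<lambda>i v. P i x \<or> v) m" for m 
      by (induction m) (auto simp: less_Suc_eq)
    then show ?thesis .
  qed
  show ?thesis unfolding eq
    by (intro effective_rec_nat effective_compose2[OF assms(2)] assms(1) effective_intros)
qed

lemma effective_Least [effective_intros]:
  fixes P :: "nat \<Rightarrow> 'a::numbered \<Rightarrow> bool"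
  assumes "effective (\<lambda>z. P (fst z) (snd z))" "\<And>x. \<exists>n. P n x"
  shows "effective (\<lambda>x. LEAST n. P n x)"
proof -
  obtain g where g: "recursive g" "\<And>k. (\<lambda>z. \<not> P (fst z) (snd z)) (decode k) = decode (g k)"
    using effective_not[OF assms(1)] by (rule effectiveE) (rule that, simp_all)
  have P: "g (prod_encode (n, x)) = 0 \<longleftrightarrow> P n (decode x)" for n x
    using g(2)[of "prod_encode (n, x)"] by (auto simp: decode_bool_def decode_prod_def decode_nat_def)
  have "recursive (\<lambda>x. LEAST n. g (prod_encode (n, x)) = 0)"
    by (rule recursive_Least[OF g(1)]) (use assms(2) P in auto)
  then show ?thesis by (rule effectiveI) (simp add: P decode_nat_def)
qed

lemma effective_div2 [effective_intros]:
  assumes "effective f"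
  shows "effective (\<lambda>x. f x div (2::nat))"
proof -
  have eq: "f x div 2 = (LEAST q. f x < 2 * q + 2)" for x
    by (rule Least_equality[symmetric]) auto
  show ?thesis unfolding eq
    by (intro effective_intros effective_compose[OF assms]) presburger
qed

subsection \<open>Rational numbers\<close>

instantiation rat :: numbered
begin
definition "decode = (\<lambda>n. (of_nat (fst_nat n) - of_nat (fst_nat (snd_nat n))) /
  of_nat (Suc (snd_nat (snd_nat n))) :: rat)"
instance
proof
  have "\<exists>n. x = decode n" for x :: rat
  proof -
    obtain p q where pq: "x = of_int p / of_int q" "q > 0"
      by (metis quotient_of_denom_pos quotient_of_div surj_pair)
    have "x = (of_nat (nat p) - of_nat (nat (- p))) / of_nat (Suc (nat (q - 1)))"
      using pq by (cases "p \<ge> 0") (auto simp: Suc_nat_eq_nat_zadd1)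
    then show ?thesis
      by (intro exI[of _ "prod_encode (nat p, prod_encode (nat (- p), nat (q - 1)))"])
        (simp add: decode_rat_def)
  qed
  then show "surj (decode :: nat \<Rightarrow> rat)" by (simp add: surj_def)
qed
end

text \<open>The functions \<open>a\<close>, \<open>b\<close> and \<open>d\<close> read the number of
  the argument, not the argument itself, since a rational does not determine a numerator and a
  denominator.\<close>

lemma effective_ratI:
  fixes f :: "'a::numbered \<Rightarrow> rat" and a b d :: "nat \<Rightarrow> nat"
  assumes "effective a" "effective b" "effective d" "\<And>n. d n > 0"
    "\<And>n. f (decode n) = (of_nat (a n) - of_nat (b n)) / of_nat (d n)"
  shows "effective f"
proof (rule effectiveI)
  show "recursive (\<lambda>n. prod_encode (a n, prod_encode (b n, d n - 1)))"
    using assms(1-3) unfolding effective_nat_iff 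
    by (intro recursive_pair recursive_diff recursive_const)
  show "f (decode n) = decode (prod_encode (a n, prod_encode (b n, d n - 1)))" for n
    using assms(4,5)[of n] by (simp add: decode_rat_def)
qed

lemma effective_fst_nat: "effective fst_nat" and effective_snd_nat: "effective snd_nat"
  by (simp_all add: effective_nat_iff recursive_fst recursive_snd)

lemma effective_fst_snd_nat [effective_intros]:
  "effective f \<Longrightarrow> effective (\<lambda>x. fst_nat (f x))"
  "effective f \<Longrightarrow> effective (\<lambda>x. snd_nat (f x))"
  by (rule effective_compose[OF effective_fst_nat] effective_compose[OF effective_snd_nat], simp)+

lemma effective_prod_encode:
  assumes "effective f"
  shows "effective (\<lambda>x. prod_encode (f x))"
proof (rule effective_compose[OF _ assms])
  show "effective prod_encode"
    by (rule effectiveI[OF recursive_id]) (simp add: decode_prod_def decode_nat_def)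
qed

lemma effective_of_nat_rat [effective_intros]:
  assumes "effective f"
  shows "effective (\<lambda>x. of_nat (f x) :: rat)"
proof (rule effective_compose[OF _ assms])
  show "effective (of_nat :: nat \<Rightarrow> rat)"
    by (rule effective_ratI[of "\<lambda>n. n" "\<lambda>n. 0" "\<lambda>n. 1"])
      (auto intro!: effective_intros simp: decode_nat_def)
qed

lemma effective_add_rat [effective_intros]:
  fixes f g :: "'a::numbered \<Rightarrow> rat"
  assumes "effective f" "effective g"
  shows "effective (\<lambda>x. f x + g x)"
proof (rule effective_compose2[OF _ assms])
  show "effective (\<lambda>z::rat \<times> rat. fst z + snd z)"
    by (rule effective_ratI[of
        "\<lambda>n. fst_nat (fst_nat n) * Suc (snd_nat (snd_nat (snd_nat n))) +
             fst_nat (snd_nat n) * Suc (snd_nat (snd_nat (fst_nat n)))"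
        "\<lambda>n. fst_nat (snd_nat (fst_nat n)) * Suc (snd_nat (snd_nat (snd_nat n))) +
             fst_nat (snd_nat (snd_nat n)) * Suc (snd_nat (snd_nat (fst_nat n)))"
        "\<lambda>n. Suc (snd_nat (snd_nat (fst_nat n))) * Suc (snd_nat (snd_nat (snd_nat n)))"])
      (intro effective_intros | simp add: decode_prod_def decode_rat_def divide_simps
        del: of_nat_Suc add: of_nat_neq_0 | simp add: algebra_simps)+
qed

lemma effective_mult_rat [effective_intros]:
  fixes f g :: "'a::numbered \<Rightarrow> rat"
  assumes "effective f" "effective g"
  shows "effective (\<lambda>x. f x * g x)"
proof (rule effective_compose2[OF _ assms])
  show "effective (\<lambda>z::rat \<times> rat. fst z * snd z)"
    by (rule effective_ratI[of
        "\<lambda>n. fst_nat (fst_nat n) * fst_nat (snd_nat n) +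
             fst_nat (snd_nat (fst_nat n)) * fst_nat (snd_nat (snd_nat n))"
        "\<lambda>n. fst_nat (snd_nat (fst_nat n)) * fst_nat (snd_nat n) +
             fst_nat (fst_nat n) * fst_nat (snd_nat (snd_nat n))"
        "\<lambda>n. Suc (snd_nat (snd_nat (fst_nat n))) * Suc (snd_nat (snd_nat (snd_nat n)))"])
      (intro effective_intros | simp add: decode_prod_def decode_rat_def divide_simps
        del: of_nat_Suc add: of_nat_neq_0 | simp add: algebra_simps)+
qed

lemma effective_uminus_rat [effective_intros]:
  fixes f :: "'a::numbered \<Rightarrow> rat"
  shows "effective f \<Longrightarrow> effective (\<lambda>x. - f x)"
  using effective_mult_rat[OF effective_const[of "-1"]] by simp

lemma effective_diff_rat [effective_intros]:
  fixes f g :: "'a::numbered \<Rightarrow> rat"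
  assumes "effective f" "effective g"
  shows "effective (\<lambda>x. f x - g x)"
  using effective_add_rat[OF assms(1) effective_uminus_rat[OF assms(2)]] by simp

lemma effective_less_rat [effective_intros]:
  fixes f g :: "'a::numbered \<Rightarrow> rat"
  assumes "effective f" "effective g"
  shows "effective (\<lambda>x. f x < g x)"
proof -
  have "effective (\<lambda>x::rat. x > 0)"
  proof -
    \<comment> \<open>Denominators are positive, so the sign is decided by comparing the two parts
      of the numerator.\<close>
    have "effective (\<lambda>n. fst_nat (snd_nat n) < fst_nat n)"
      by (intro effective_intros)
    then obtain h where h: "recursive h"
      "\<And>k. (\<lambda>n. fst_nat (snd_nat n) < fst_nat n) (decode k) = decode (h k)"
      by (rule effectiveE) (rule that, simp_all)
    have "(decode n :: rat) > 0 \<longleftrightarrow> fst_nat n > fst_nat (snd_nat n)" for n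
      by (simp add: decode_rat_def zero_less_divide_iff del: of_nat_Suc)
    with h show ?thesis by (intro effectiveI[of h]) (auto simp: decode_nat_def)
  qed
  from effective_compose[OF this effective_diff_rat[OF assms(2,1)]] show ?thesis by simp
qed

lemma effective_le_rat [effective_intros]:
  fixes f g :: "'a::numbered \<Rightarrow> rat"
  assumes "effective f" "effective g"
  shows "effective (\<lambda>x. f x \<le> g x)"
  using effective_not[OF effective_less_rat[OF assms(2,1)]] by (simp add: not_less)

lemma effective_max_rat [effective_intros]:
  fixes f g :: "'a::numbered \<Rightarrow> rat"
  shows "effective f \<Longrightarrow> effective g \<Longrightarrow> effective (\<lambda>x. max (f x) (g x))"
  unfolding max_def by (intro effective_intros)

lemma effective_power_rat [effective_intros]:
  fixes f :: "'a::numbered \<Rightarrow> rat"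
  assumes "effective f" "effective g"
  shows "effective (\<lambda>x. f x ^ g x)"
proof -
  have eq: "f x ^ g x = rec_nat 1 (\<lambda>i v. v * f x) (g x)" for x
  proof -
    have "f x ^ n = rec_nat 1 (\<lambda>i v. v * f x) n" for n by (induction n) auto
    then show ?thesis .
  qed
  show ?thesis unfolding eq
    by (intro effective_rec_nat effective_compose[OF assms(1)] assms(2) effective_intros)
qed

lemma effective_sum_rat [effective_intros]:
  fixes F :: "nat \<Rightarrow> 'a::numbered \<Rightarrow> rat"
  assumes "effective n" "effective (\<lambda>z. F (fst z) (snd z))"
  shows "effective (\<lambda>x. \<Sum>i<n x. F i x)"
proof -
  have eq: "(\<Sum>i<n x. F i x) = rec_nat 0 (\<lambda>i v. v + F i x) (n x)" for x
  proof -
    have "(\<Sum>i<m. F i x) = rec_nat 0 (\<lambda>i v. v + F i x) m" for m by (induction m) auto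
    then show ?thesis .
  qed
  show ?thesis unfolding eq
    by (intro effective_rec_nat effective_compose2[OF assms(2)] assms(1) effective_intros)
qed

subsection \<open>Computable functions on argument lists\<close>

lemma computable_1_iff: "computable 1 f \<longleftrightarrow> effective (\<lambda>x. f [x])"
proof -
  have "(\<forall>xs. length xs = 1 \<longrightarrow> computes e xs (f xs)) \<longleftrightarrow> (\<forall>x. computes e [x] (f [x]))" for e
    by (auto simp: length_Suc_conv)
  then show ?thesis unfolding computable_def effective_nat_iff recursive_def by simp
qed

lemma computable_2_iff: "computable 2 f \<longleftrightarrow> effective (\<lambda>z. f [fst z, snd z])"
proof
  assume "computable 2 f"
  then obtain e where "\<forall>xs. length xs = 2 \<longrightarrow> computes e xs (f xs)"
    unfolding computable_def by blast
  then have e: "computes e [x, y] (f [x, y])" for x y by simp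
  have "computes (Comp e [fst_recf, snd_recf]) [n] (f [fst_nat n, snd_nat n])" for n
    by (rule computes_comp2[OF computes_fst computes_snd e])
  then have "recursive (\<lambda>n. f [fst_nat n, snd_nat n])" unfolding recursive_def by blast
  then show "effective (\<lambda>z. f [fst z, snd z])"
    by (rule effectiveI) (simp add: decode_prod_def decode_nat_def)
next
  assume "effective (\<lambda>z. f [fst z, snd z])"
  then obtain g where g: "recursive g" "\<And>n. (\<lambda>z. f [fst z, snd z]) (decode n) = decode (g n)"
    by (rule effectiveE) (rule that, simp_all)
  from g(1) obtain e where e: "computes e [x] (g x)" for x unfolding recursive_def by blast
  have "computes (Comp e [Comp add_recf [Comp triangle_recf [add_recf], Proj 0]]) [x, y] (f [x, y])" for x y
    using computes_comp1[OF computes_prod_encode e] g(2)[of "prod_encode (x, y)"]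
    by (simp add: decode_prod_def decode_nat_def)
  then show "computable 2 f" unfolding computable_def
    by (auto simp: numeral_2_eq_2 length_Suc_conv)
qed

text \<open>On natural numbers the argument is its own number, so here the components of the
  fraction are functions of the argument, as \<open>computable_rat\<close> demands.\<close>

lemma effective_rat_numerators:
  fixes f :: "nat \<Rightarrow> rat"
  assumes "effective f"
  obtains a b d :: "nat \<Rightarrow> nat" where "effective a" "effective b" "effective d"
    "\<And>x. d x > 0" "\<And>x. f x = (of_nat (a x) - of_nat (b x)) / of_nat (d x)"
proof -
  obtain g where g: "recursive g" "\<And>n. f n = decode (g n)"
    using effectiveE[OF assms] unfolding decode_nat_def by metis
  note [effective_intros] = effective_natI[OF g(1)]
  show ?thesis
    by (rule that[of "\<lambda>n. fst_nat (g n)" "\<lambda>n. fst_nat (snd_nat (g n))" "\<lambda>n. Suc (snd_nat (snd_nat (g n)))"])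
      (intro effective_intros | simp add: g(2) decode_rat_def)+
qed

lemma computable_rat_seq_iff: "computable_rat_seq q \<longleftrightarrow> effective q"
proof
  assume "computable_rat_seq q"
  then obtain a b d where *: "computable 1 a" "computable 1 b" "computable 1 d"
    "\<forall>xs. length xs = 1 \<longrightarrow> d xs > 0 \<and> q (xs ! 0) = (of_nat (a xs) - of_nat (b xs)) / of_nat (d xs)"
    unfolding computable_rat_def by blast
  from *(4) have "d [x] > 0 \<and> q x = (of_nat (a [x]) - of_nat (b [x])) / of_nat (d [x])" for x
    by (metis One_nat_def length_Cons list.size(3) nth_Cons_0)
  with *(1-3) show "effective q" unfolding computable_1_iff
    by (intro effective_ratI[of "\<lambda>x. a [x]" "\<lambda>x. b [x]" "\<lambda>x. d [x]"]) (auto simp: decode_nat_def)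
next
  assume "effective q"
  then obtain a b d where "effective a" "effective b" "effective d" "\<And>x::nat. d x > (0::nat)"
     "\<And>x. q x = (of_nat (a x) - of_nat (b x)) / of_nat (d x)"
    by (rule effective_rat_numerators) blast
  then show "computable_rat_seq q" unfolding computable_rat_def computable_1_iff
    by (intro exI[of _ "\<lambda>xs. a (xs ! 0)"] exI[of _ "\<lambda>xs. b (xs ! 0)"] exI[of _ "\<lambda>xs. d (xs ! 0)"])
      simp
qed

lemma computable_rat_seq2_iff: "computable_rat_seq2 q \<longleftrightarrow> effective (\<lambda>z. q (fst z) (snd z))"
proof
  assume "computable_rat_seq2 q"
  then obtain a b d where *: "computable 2 a" "computable 2 b" "computable 2 d"
    "\<forall>xs. length xs = 2 \<longrightarrow> d xs > 0 \<and> q (xs ! 0) (xs ! 1) = (of_nat (a xs) - of_nat (b xs)) / of_nat (d xs)"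
    unfolding computable_rat_def by blast
  have "d [x, y] > 0 \<and> q x y = (of_nat (a [x, y]) - of_nat (b [x, y])) / of_nat (d [x, y])" for x y
    using *(4)[rule_format, of "[x, y]"] by simp
  moreover
  have "effective (\<lambda>n. f [fst_nat n, snd_nat n])" if "computable 2 f" for f
    using that effective_compose2[of "\<lambda>x y. f [x, y]", OF _ effective_fst_nat effective_snd_nat]
    unfolding computable_2_iff by simp
  ultimately show "effective (\<lambda>z. q (fst z) (snd z))"
    using *(1-3) by (intro effective_ratI[of "\<lambda>n. a [fst_nat n, snd_nat n]" "\<lambda>n. b [fst_nat n, snd_nat n]"
          "\<lambda>n. d [fst_nat n, snd_nat n]"]) (auto simp: decode_prod_def decode_nat_def)
next
  assume "effective (\<lambda>z. q (fst z) (snd z))"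
  then have "effective (\<lambda>n. q (fst_nat n) (snd_nat n))"
    by (rule effective_compose2) (intro effective_intros)+
  then obtain a b d where *: "effective a" "effective b" "effective d" "\<And>x::nat. d x > (0::nat)"
     "\<And>x. q (fst_nat x) (snd_nat x) = (of_nat (a x) - of_nat (b x)) / of_nat (d x)"
    by (rule effective_rat_numerators) blast
  have "computable 2 (\<lambda>xs. f (prod_encode (xs ! 0, xs ! 1)))" if "effective f" for f
    unfolding computable_2_iff using effective_compose[OF that effective_prod_encode[OF effective_id]] by simp
  with * show "computable_rat_seq2 q" unfolding computable_rat_def 
    by (intro exI[of _ "\<lambda>xs. a (prod_encode (xs ! 0, xs ! 1))"] 
        exI[of _ "\<lambda>xs. b (prod_encode (xs ! 0, xs ! 1))"] exI[of _ "\<lambda>xs. d (prod_encode (xs ! 0, xs ! 1))"])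
      (use *(5)[of "prod_encode (_, _)"] in auto)
qed

subsection \<open>Step-bounded evaluation of a program\<close>

text \<open>The value \<open>0\<close> means that no result is found within \<open>s\<close> steps, and \<open>Suc y\<close> is the result \<open>y\<close>.
  Only the searches of \<open>Minim\<close> are bounded by \<open>s\<close>.\<close>

fun eval_steps :: "recf \<Rightarrow> nat \<Rightarrow> nat list \<Rightarrow> nat" where
  "eval_steps Zero s xs = 1"
| "eval_steps Succ s xs = (case xs of [] \<Rightarrow> 0 | x # _ \<Rightarrow> Suc (Suc x))"
| "eval_steps (Proj i) s xs = (if i < length xs then Suc (xs ! i) else 0)"
| "eval_steps (Comp f gs) s xs =
    (if \<forall>g\<in>set gs. eval_steps g s xs \<noteq> 0
     then eval_steps f s (map (\<lambda>g. eval_steps g s xs - 1) gs) else 0)"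
| "eval_steps (PrimRec f g) s xs =
    (case xs of [] \<Rightarrow> 0
     | n # xs' \<Rightarrow> rec_nat (eval_steps f s xs')
         (\<lambda>i v. if v = 0 then 0 else eval_steps g s (i # (v - 1) # xs')) n)"
| "eval_steps (Minim f) s xs =
    (let n = (LEAST n. s \<le> n \<or> eval_steps f s (n # xs) \<le> 1)
     in if eval_steps f s (n # xs) = 1 then Suc n else 0)"

lemma eval_steps_sound: "eval_steps e s xs = Suc y \<Longrightarrow> computes e xs y"
proof (induction e arbitrary: xs y)
  case Zero
  then show ?case by (simp add: computes.zero)
next
  case Succ
  then show ?case by (auto simp: computes.succ split: list.splits)
next
  case (Proj i)
  then show ?case by (auto simp: computes_proj split: if_splits)
next
  case (Comp f gs)
  from Comp.prems have ne: "\<forall>g\<in>set gs. eval_steps g s xs \<noteq> 0"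
    and f: "eval_steps f s (map (\<lambda>g. eval_steps g s xs - 1) gs) = Suc y"
    by (auto split: if_splits)
  have "list_all2 (\<lambda>g y. computes g xs y) gs (map (\<lambda>g. eval_steps g s xs - 1) gs)"
    using ne Comp.IH(2) by (auto simp: list_all2_conv_all_nth)
  then show ?case by (rule computes.comp) (rule Comp.IH(1)[OF f])
next
  case (PrimRec f g)
  from PrimRec.prems obtain n xs' where xs: "xs = n # xs'" by (auto split: list.splits)
  let ?R = "rec_nat (eval_steps f s xs')
         (\<lambda>i v. if v = 0 then 0 else eval_steps g s (i # (v - 1) # xs'))"
  have "?R n = Suc y \<Longrightarrow> computes (PrimRec f g) (n # xs') y" for y
  proof (induction n arbitrary: y)
    case 0
    then show ?case by (simp add: computes.prim_0 PrimRec.IH(1))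
  next
    case (Suc n)
    then obtain v where v: "?R n = Suc v" "eval_steps g s (n # v # xs') = Suc y"
      by (cases "?R n") auto
    show ?case by (rule computes.prim_Suc[OF Suc.IH[OF v(1)] PrimRec.IH(2)[OF v(2)]])
  qed
  then show ?case using PrimRec.prems xs by simp
next
  case (Minim f)
  define n where "n = (LEAST n. s \<le> n \<or> eval_steps f s (n # xs) \<le> 1)"
  from Minim.prems have n: "eval_steps f s (n # xs) = Suc 0" "n = y"
    by (auto simp: Let_def n_def split: if_splits)
  \<comment> \<open>Value 0 means no result and value 1 means the result 0. Below the least index
    both are excluded, so \<open>f\<close> halts there with a positive result.\<close>
  have "\<exists>v. computes f (i # xs) (Suc v)" if "i < n" for i
  proof -
    have "\<not> eval_steps f s (i # xs) \<le> 1"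
      using not_less_Least[of i "\<lambda>n. s \<le> n \<or> eval_steps f s (n # xs) \<le> 1"] that
      unfolding n_def by blast
    then obtain v where "eval_steps f s (i # xs) = Suc (Suc v)"
      by (metis One_nat_def not_less_eq_eq zero_le old.nat.exhaust)
    then show ?thesis using Minim.IH by blast
  qed
  then show ?case using Minim.IH n by (auto intro: computes.minim)
qed

text \<open>The conclusion holds for all large bounds, not just for one, so that the finitely many
  subcomputations of \<open>Comp\<close> and \<open>Minim\<close> can share a bound.\<close>

lemma eval_steps_complete:
  "computes e xs y \<Longrightarrow> \<forall>\<^sub>F s in sequentially. eval_steps e s xs = Suc y"
proof (induction rule: computes.induct)
  case (comp xs gs ys f z)
  have "\<forall>\<^sub>F s in sequentially. list_all2 (\<lambda>g y. eval_steps g s xs = Suc y) gs ys"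
    using comp.IH(1)
  proof (induction rule: list_all2_induct)
    case (Cons g gs y ys)
    then show ?case by (auto intro: eventually_conj)
  qed simp
  with comp.IH(2) show ?case
  proof eventually_elim
    case (elim s)
    then have "map (\<lambda>g. eval_steps g s xs - 1) gs = ys"
      by (auto simp: list_all2_conv_all_nth intro!: nth_equalityI)
    moreover have "\<forall>g\<in>set gs. eval_steps g s xs \<noteq> 0"
      using elim(2) by (auto simp: list_all2_conv_all_nth in_set_conv_nth)
    ultimately show ?case using elim(1) by simp
  qed
next
  case (prim_Suc f g n xs y z)
  from prim_Suc.IH show ?case by eventually_elim simp
next
  case (minim f n xs)
  have "\<forall>\<^sub>F s in sequentially. \<forall>i\<in>{..<n}. \<exists>y. eval_steps f s (i # xs) = Suc (Suc y)"
  proof (rule eventually_ball_finite, simp, intro ballI)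
    fix i assume "i \<in> {..<n}"
    then obtain y where "\<forall>\<^sub>F s in sequentially. eval_steps f s (i # xs) = Suc (Suc y)"
      using minim.IH(2) by auto
    then show "\<forall>\<^sub>F s in sequentially. \<exists>y. eval_steps f s (i # xs) = Suc (Suc y)"
      by eventually_elim blast
  qed
  with minim.IH(1) eventually_ge_at_top[of n] show ?case
  proof eventually_elim
    case (elim s)
    have "(LEAST n. s \<le> n \<or> eval_steps f s (n # xs) \<le> 1) = n"
    proof (rule Least_equality)
      fix i assume "s \<le> i \<or> eval_steps f s (i # xs) \<le> 1"
      then show "n \<le> i" using elim(2,3) by (metis lessThan_iff not_less dual_order.trans not_less_eq_eq One_nat_def Suc_le_mono zero_le)
    qed (use elim in simp)
    then show ?case using elim by (simp add: Let_def)
  qed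
qed auto

lemma computes_iff_eval_steps: "computes e xs y \<longleftrightarrow> (\<exists>s. eval_steps e s xs = Suc y)"
  using eval_steps_sound eventually_happens[OF eval_steps_complete] by auto

lemma effective_Ball_set:
  assumes "\<And>g. g \<in> set gs \<Longrightarrow> effective (P g)"
  shows "effective (\<lambda>x. \<forall>g\<in>set gs. P g x)"
  using assms by (induction gs) (auto intro!: effective_const effective_conj)

text \<open>The context of the arguments is coded by a number, so that the induction hypothesis can
  be used in the larger contexts of primitive recursion and minimization.\<close>

lemma effective_eval_steps_nat:
  fixes s :: "nat \<Rightarrow> nat"
  assumes "effective s" "\<And>h. h \<in> set hs \<Longrightarrow> effective h"
  shows "effective (\<lambda>x. eval_steps e (s x) (map (\<lambda>h. h x) hs))"
  using assms
proof (induction e arbitrary: s hs)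
  case Zero
  show ?case by (simp add: effective_const)
next
  case Succ
  then show ?case by (cases hs) (auto intro!: effective_intros)
next
  case (Proj i)
  then show ?case by (cases "i < length hs") (auto intro!: effective_intros)
next
  case (Comp f gs)
  let ?g = "\<lambda>g x. eval_steps g (s x) (map (\<lambda>h. h x) hs)"
  have g: "effective (?g g)" if "g \<in> set gs" for g
    by (rule Comp.IH(2)[OF that Comp.prems]) 
  have "effective (\<lambda>x. eval_steps f (s x) (map (\<lambda>h. h x) (map (\<lambda>g x. ?g g x - 1) gs)))"
    by (rule Comp.IH(1)[OF Comp.prems(1)]) (auto intro!: effective_diff_nat effective_const g)
  then have f: "effective (\<lambda>x. eval_steps f (s x) (map (\<lambda>g. ?g g x - 1) gs))"
    by (simp add: comp_def)
  have "effective (\<lambda>x. \<forall>g\<in>set gs. ?g g x \<noteq> 0)"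
    by (rule effective_Ball_set) (rule effective_neq_0[OF g])
  from effective_If[OF this f effective_const[of 0]] show ?case by simp
next
  case (PrimRec f g)
  show ?case
  proof (cases hs)
    case Nil
    then show ?thesis by (simp add: effective_const)
  next
    case (Cons h hs')
    \<comment> \<open>The number \<open>n\<close> packs the counter, the previous value in its
      shifted form, and the old context; hence the subtraction of 1 from the second entry.\<close>
    have "effective (\<lambda>n. eval_steps g (s (snd_nat (snd_nat n)))
        (map (\<lambda>h. h n) (fst_nat # (\<lambda>n. fst_nat (snd_nat n) - 1) # map (\<lambda>h n. h (snd_nat (snd_nat n))) hs')))"
    proof (rule PrimRec.IH(2))
      show "effective (\<lambda>n. s (snd_nat (snd_nat n)))"
        by (rule effective_compose[OF PrimRec.prems(1)]) (intro effective_intros)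
      fix k assume "k \<in> set (fst_nat # (\<lambda>n. fst_nat (snd_nat n) - 1) # map (\<lambda>h n. h (snd_nat (snd_nat n))) hs')"
      then consider "k = fst_nat" | "k = (\<lambda>n. fst_nat (snd_nat n) - 1)"
        | h' where "h' \<in> set hs'" "k = (\<lambda>n. h' (snd_nat (snd_nat n)))" by auto
      then show "effective k"
      proof cases
        case 3
        then have "effective h'" using PrimRec.prems(2) Cons by simp
        then show ?thesis unfolding 3(2) by (rule effective_compose) (intro effective_intros)
      qed (simp_all only:, (intro effective_intros)+)
    qed
    from effective_compose[OF this, of "\<lambda>z. prod_encode (fst z, prod_encode (snd z))"]
    have g: "effective (\<lambda>z. eval_steps g (s (snd (snd z)))
        (fst z # (fst (snd z) - 1) # map (\<lambda>h. h (snd (snd z))) hs'))"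
      by (simp add: comp_def effective_intros effective_prod_encode)
    have "effective (\<lambda>x. eval_steps f (s x) (map (\<lambda>h. h x) hs'))" "effective h"
      using PrimRec.prems Cons by (auto intro: PrimRec.IH(1))
    note [effective_intros] = this g
    have "effective (\<lambda>x. rec_nat (eval_steps f (s x) (map (\<lambda>h. h x) hs'))
         (\<lambda>i v. if v = 0 then 0 else eval_steps g (s x) (i # (v - 1) # map (\<lambda>h. h x) hs')) (h x))"
      by (intro effective_intros)
    then show ?thesis by (simp add: Cons)
  qed
next
  case (Minim f)
  have "effective (\<lambda>n. eval_steps f (s (snd_nat n))
        (map (\<lambda>h. h n) (fst_nat # map (\<lambda>h n. h (snd_nat n)) hs)))"
  proof (rule Minim.IH)
    show "effective (\<lambda>n. s (snd_nat n))"
      by (rule effective_compose[OF Minim.prems(1)]) (intro effective_intros)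
    fix k assume "k \<in> set (fst_nat # map (\<lambda>h n. h (snd_nat n)) hs)"
    then consider "k = fst_nat" | h' where "h' \<in> set hs" "k = (\<lambda>n. h' (snd_nat n))" by auto
    then show "effective k"
    proof cases
      case 2
      show ?thesis unfolding 2(2)
        by (rule effective_compose[OF Minim.prems(2)[OF 2(1)]]) (intro effective_intros)
    qed (simp only:, intro effective_intros)
  qed
  from effective_compose[OF this, of prod_encode]
  have f: "effective (\<lambda>z. eval_steps f (s (snd z)) (fst z # map (\<lambda>h. h (snd z)) hs))"
    using effective_prod_encode[OF effective_id] by (simp add: comp_def)
  let ?n = "\<lambda>x. LEAST n. s x \<le> n \<or> eval_steps f (s x) (n # map (\<lambda>h. h x) hs) \<le> 1"
  have n: "effective ?n"
    by (intro effective_Least effective_intros f effective_compose[OF Minim.prems(1)]) auto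
  have "effective (\<lambda>x. if eval_steps f (s x) (?n x # map (\<lambda>h. h x) hs) = 1 then Suc (?n x) else 0)"
    using effective_compose2[OF f n effective_id]
    by (intro effective_intros n) auto
  then show ?case unfolding eval_steps.simps Let_def .
qed

lemma effective_eval_steps:
  "effective (\<lambda>z. eval_steps e (fst z) [snd z])"
proof -
  have "effective (\<lambda>n. eval_steps e (fst_nat n) (map (\<lambda>h. h n) [snd_nat]))"
    by (rule effective_eval_steps_nat) (auto intro: effective_fst_nat effective_snd_nat)
  from effective_compose[OF this effective_prod_encode[OF effective_id]]
  show ?thesis by simp
qed

text \<open>This programs the machine that serves requests: \<open>s\<close> runs over candidate
  stages, and \<open>F\<close> extracts the output from the first successful one.\<close>

lemma search_recf:
  fixes P :: "nat \<Rightarrow> nat \<Rightarrow> bool" and F :: "nat \<Rightarrow> nat"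
  assumes "effective (\<lambda>z. P (fst z) (snd z))" "effective F"
  shows "\<exists>e. \<forall>x n. computes e [x] n \<longleftrightarrow> (\<exists>s. P s x) \<and> n = F (LEAST s. P s x)"
proof -
  have "effective (\<lambda>n. \<not> P (fst_nat n) (snd_nat n))"
    by (intro effective_not effective_compose2[OF assms(1)] effective_fst_nat effective_snd_nat)
  then obtain g where g: "recursive g" "\<And>k. (\<lambda>n. \<not> P (fst_nat n) (snd_nat n)) (decode k) = decode (g k)"
    by (rule effectiveE) (rule that, simp_all)
  have P: "g (prod_encode (s, x)) = 0 \<longleftrightarrow> P s x" for s x
    using g(2)[of "prod_encode (s, x)"] by (auto simp: decode_bool_def decode_nat_def)
  obtain eF where eF: "\<And>x. computes eF [x] (F x)"
    using assms(2) unfolding effective_nat_iff recursive_def by blast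
  obtain e where e: "\<And>x n. computes e [x] n \<longleftrightarrow> (\<exists>s. P s x) \<and> n = (LEAST s. P s x)"
    using minimization_recf[OF g(1)] unfolding P by blast
  have "computes (Comp eF [e]) [x] n \<longleftrightarrow> (\<exists>s. P s x) \<and> n = F (LEAST s. P s x)" for x n
  proof
    assume "computes (Comp eF [e]) [x] n"
    then obtain y where "computes e [x] y" "computes eF [y] n"
      by cases (auto simp: list_all2_Cons1)
    then show "(\<exists>s. P s x) \<and> n = F (LEAST s. P s x)"
      using e eF computes_functional by blast
  next
    assume "(\<exists>s. P s x) \<and> n = F (LEAST s. P s x)"
    then show "computes (Comp eF [e]) [x] n" using computes_comp1[OF _ eF] e by blast
  qed
  then show ?thesis by blast
qed

section \<open>Strings as dyadic intervals\<close>

lemma bits_code_Nil [simp]: "bits_code [] = 1"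
  by (simp add: bits_code_def)

lemma bits_code_snoc [simp]: "bits_code (p @ [b]) = 2 * bits_code p + of_bool b"
  by (simp add: bits_code_def)

lemma bits_code_bounds: "2 ^ length p \<le> bits_code p" "bits_code p < 2 ^ Suc (length p)"
  by (induction p rule: rev_induct) auto

lemma bits_code_append_div: "bits_code (p @ q) div 2 ^ length q = bits_code p"
proof (induction q rule: rev_induct)
  case (snoc b q)
  have "bits_code (p @ q @ [b]) div 2 ^ length (q @ [b]) = bits_code ((p @ q) @ [b]) div 2 div 2 ^ length q"
    by (simp add: div_mult2_eq del: bits_code_snoc)
  also have "\<dots> = bits_code (p @ q) div 2 ^ length q" by (subst bits_code_snoc) simp
  finally show ?case using snoc by simp
qed simp

text \<open>For positive \<open>x\<close> this is the binary logarithm rounded down, that is, the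
  length of the string with code \<open>x\<close>.\<close>

definition code_length :: "nat \<Rightarrow> nat" where
  "code_length x = (LEAST l. x < 2 ^ Suc l)"

lemma code_length_eqI: "2 ^ l \<le> x \<Longrightarrow> x < 2 ^ Suc l \<Longrightarrow> code_length x = l"
  unfolding code_length_def
proof (rule Least_equality)
  fix k assume "2 ^ l \<le> x" "x < 2 ^ Suc k"
  then have "(2::nat) ^ l < 2 ^ Suc k" by linarith
  then show "l \<le> k" using power_less_imp_less_exp[of "2::nat" l "Suc k"] by simp
qed

lemma code_length_bits_code [simp]: "code_length (bits_code p) = length p"
  by (intro code_length_eqI bits_code_bounds)

lemma effective_code_length [effective_intros]:
  assumes "effective f" shows "effective (\<lambda>x. code_length (f x))"
proof (rule effective_compose[OF _ assms])
  have "\<exists>l. x < 2 ^ Suc l" for x :: nat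
    using less_exp[of "Suc x"] by (intro exI[of _ x]) linarith
  then show "effective code_length"
    unfolding code_length_def by (intro effective_Least effective_intros)
qed

text \<open>The leading one makes the length readable from the code; for equal lengths the digits
  are compared from the last one on.\<close>

lemma inj_bits_code: "inj bits_code"
proof (rule injI)
  fix p q assume eq: "bits_code p = bits_code q"
  then have "length p = length q" by (metis code_length_bits_code)
  then show "p = q" using eq
  proof (induction p arbitrary: q rule: rev_induct)
    case (snoc b p)
    then obtain q' c where q: "q = q' @ [c]" by (cases q rule: rev_cases) auto
    with snoc.prems have "2 * bits_code p + of_bool b = 2 * bits_code q' + of_bool c" by simp
    then have "bits_code p = bits_code q' \<and> b = c" by (cases b; cases c) (auto, presburger+)
    with snoc q show ?case by simp
  qed simp
qed

lemma bits_code_surj: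
  assumes "x > 0"
  obtains p where "bits_code p = x"
proof -
  have "\<exists>p. bits_code p = x" using assms
  proof (induction x rule: less_induct)
    case (less x)
    show ?case
    proof (cases "x = 1")
      case True
      then show ?thesis by (intro exI[of _ "[]"]) simp
    next
      case False
      with less.prems have "x div 2 < x" "x div 2 > 0" by auto
      then obtain p where "bits_code p = x div 2" using less.IH by blast
      then have "bits_code (p @ [odd x]) = x" by (auto simp: odd_two_times_div_two_succ)
      then show ?thesis by blast
    qed
  qed
  then show ?thesis using that by blast
qed

text \<open>Dropping the last digits of a binary notation is integer division by a power of two, and
  the coding is injective.\<close>

lemma prefix_iff_bits_code:
  "prefix p q \<longleftrightarrow> length p \<le> length q \<and> bits_code q div 2 ^ (length q - length p) = bits_code p"
proof
  assume "prefix p q"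
  then show "length p \<le> length q \<and> bits_code q div 2 ^ (length q - length p) = bits_code p"
    by (auto simp: prefix_def bits_code_append_div)
next
  assume *: "length p \<le> length q \<and> bits_code q div 2 ^ (length q - length p) = bits_code p"
  have "bits_code (take (length p) q) = bits_code q div 2 ^ (length q - length p)"
    using bits_code_append_div[of "take (length p) q" "drop (length p) q"] by simp
  with * have "take (length p) q = p" using injD[OF inj_bits_code] by simp
  then show "prefix p q" by (metis take_is_prefix)
qed

text \<open>The string \<open>p\<close> stands for the interval of the numbers in \<open>[1, 2)\<close> whose binary digits
  after the leading one start with \<open>p\<close>.\<close>

definition code_lo :: "nat \<Rightarrow> 'a::linordered_field" where
  "code_lo x = of_nat x * (1/2) ^ code_length x"

definition code_hi :: "nat \<Rightarrow> 'a::linordered_field" where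
  "code_hi x = (of_nat x + 1) * (1/2) ^ code_length x"

lemma code_hi_diff_lo: "code_hi x - code_lo x = (1/2) ^ code_length x"
  by (simp add: code_lo_def code_hi_def algebra_simps)

lemma code_lo_less_hi: "code_lo x < (code_hi x :: 'a::linordered_field)"
  using code_hi_diff_lo[of x, where ?'a = 'a] by (metis diff_gt_0_iff_gt zero_less_divide_1_iff zero_less_numeral zero_less_power)

lemma code_bounds: "1 \<le> (code_lo (bits_code p) :: 'a::linordered_field)"
    "code_hi (bits_code p) \<le> (2 :: 'a)"
proof -
  have "(2::'a) ^ length p \<le> of_nat (bits_code p)"
    using bits_code_bounds(1)[of p] by (metis of_nat_le_iff of_nat_numeral of_nat_power)
  then show "1 \<le> (code_lo (bits_code p) :: 'a)"
    by (simp add: code_lo_def power_divide field_simps)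
  have "of_nat (bits_code p + 1) \<le> (of_nat (2 ^ Suc (length p)) :: 'a)"
    using bits_code_bounds(2)[of p] by (intro of_nat_mono) simp
  then show "code_hi (bits_code p) \<le> (2 :: 'a)"
    by (simp add: code_hi_def power_divide field_simps)
qed

lemma prefix_code_nested:
  assumes "prefix p q"
  shows "code_lo (bits_code p) \<le> (code_lo (bits_code q) :: 'a::linordered_field)"
    "code_hi (bits_code q) \<le> (code_hi (bits_code p) :: 'a)"
proof -
  define r x y where "r = length q - length p" and "x = bits_code p" and "y = bits_code q"
  have len: "length q = length p + r" and div: "y div 2 ^ r = x"
    using assms unfolding prefix_iff_bits_code r_def x_def y_def by auto
  have cl: "code_length x = length p" "code_length y = length p + r"
    by (simp_all add: x_def y_def len)
  \<comment> \<open>All four endpoints are multiples of the length of the shorter interval, which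
    turns the claim into one about integers.\<close>
  let ?u = "(1/2 :: 'a) ^ (length p + r)"
  have eqs: "code_lo x = of_nat (x * 2 ^ r) * ?u" "code_hi x = of_nat ((x + 1) * 2 ^ r) * ?u"
    "code_lo y = of_nat y * ?u" "code_hi y = of_nat (y + 1) * ?u"
    unfolding code_lo_def code_hi_def cl by (simp_all add: power_add power_divide field_simps)
  have u: "?u > 0" by simp
  have "x * 2 ^ r \<le> y" "y + 1 \<le> (x + 1) * 2 ^ r"
    using div by (auto, metis add.commute dividend_less_div_times pos2 zero_less_power Suc_leI mult.commute)
  then have "of_nat (x * 2 ^ r) \<le> (of_nat y :: 'a)" "of_nat (y + 1) \<le> (of_nat ((x + 1) * 2 ^ r) :: 'a)"
    using of_nat_mono by blast+
  then show "code_lo (bits_code p) \<le> (code_lo (bits_code q) :: 'a)"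
    "code_hi (bits_code q) \<le> (code_hi (bits_code p) :: 'a)"
    unfolding x_def[symmetric] y_def[symmetric] eqs mult_le_cancel_right_pos[OF u] .
qed

text \<open>In units of the shorter interval, the overlap forces \<open>y\<close> into the block of
  \<open>2 ^ r\<close> integers that belongs to \<open>x\<close>. Dyadic intervals are thus nested
  or disjoint.\<close>

lemma overlap_imp_prefix:
  assumes "length p \<le> length q" "code_lo (bits_code p) < (code_hi (bits_code q) :: 'a::linordered_field)"
    "code_lo (bits_code q) < (code_hi (bits_code p) :: 'a)"
  shows "prefix p q"
proof -
  define r x y where "r = length q - length p" and "x = bits_code p" and "y = bits_code q"
  have len: "length q = length p + r" using assms(1) r_def by simp
  have cl: "code_length x = length p" "code_length y = length p + r"
    by (simp_all add: x_def y_def len)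
  let ?u = "(1/2 :: 'a) ^ (length p + r)"
  have eqs: "code_lo x = of_nat (x * 2 ^ r) * ?u" "code_hi x = of_nat ((x + 1) * 2 ^ r) * ?u"
    "code_lo y = of_nat y * ?u" "code_hi y = of_nat (y + 1) * ?u"
    unfolding code_lo_def code_hi_def cl by (simp_all add: power_add power_divide field_simps)
  have u: "?u > 0" by simp
  have "of_nat (x * 2 ^ r) < (of_nat (y + 1) :: 'a)" "of_nat y < (of_nat ((x + 1) * 2 ^ r) :: 'a)"
    using assms(2,3)
    unfolding x_def[symmetric] y_def[symmetric] eqs mult_less_cancel_right_pos[OF u] .
  then have "x * 2 ^ r < y + 1" "y < (x + 1) * 2 ^ r"
    unfolding of_nat_less_iff by auto
  then have "y div 2 ^ r = x"
    by (intro div_nat_eqI) (auto simp: mult.commute)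
  then show ?thesis using assms(1) unfolding prefix_iff_bits_code r_def x_def y_def by simp
qed

section \<open>Prefix complexity\<close>

text \<open>The requests are served from left to right: request \<open>j\<close> receives the interval of length
  \<open>w j\<close> that starts at the sum of the earlier weights (shifted by 1), and its codes are the
  maximal dyadic intervals inside it. One of them has length at least \<open>w j / 4\<close>.\<close>

lemma optimal_machine_serves_requests:
  fixes w :: "nat \<Rightarrow> rat" and P :: "nat \<Rightarrow> nat \<Rightarrow> bool"
  assumes U: "optimal_machine U" and w: "effective w" "\<And>j. w j \<ge> 0" "\<And>n. (\<Sum>j<n. w j) \<le> 1"
    and P: "effective (\<lambda>z. P (fst z) (snd z))"
  shows "\<exists>d. \<forall>j l n. w j \<ge> (1/2) ^ l \<and> P j n \<longrightarrow>
    (\<exists>n' q. P j n' \<and> U q = Some n' \<and> length q \<le> l + d)"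
proof -
  define S where "S j = (\<Sum>i<j. w i)" for j
  define A where "A x j \<longleftrightarrow> 1 + S j \<le> code_lo x \<and> code_hi x \<le> 1 + S (Suc j)" for x j
  \<comment> \<open>Halving a code drops the last bit of the string, so the second condition says
    that the interval is maximal in its slot.\<close>
  define fits where "fits x j \<longleftrightarrow> A x j \<and> \<not> A (x div 2) j" for x j
  \<comment> \<open>A stage guesses a request together with a value permitted by it.\<close>
  define R where "R s x \<longleftrightarrow> fits x (fst_nat s) \<and> P (fst_nat s) (snd_nat s)" for s x
  define V where "V p = (if \<exists>s. R s (bits_code p) then Some (snd_nat (LEAST s. R s (bits_code p))) else None)" for p
  have S_mono: "S i \<le> S j" if "i \<le> j" for i j
    unfolding S_def using that w(2) by (intro sum_mono2) auto
  have S_nonneg: "S j \<ge> 0" for j unfolding S_def using w(2) by (intro sum_nonneg) auto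
  \<comment> \<open>Different slots do not overlap, so they cannot contain nested intervals.\<close>
  have unique: "i = j" if "A x i" "A y j" "code_lo x \<le> (code_lo y :: rat)" "code_hi y \<le> (code_hi x :: rat)"
    for x y i j
  proof (rule ccontr)
    assume "i \<noteq> j"
    then consider "Suc i \<le> j" | "Suc j \<le> i" by linarith
    then show False
      using S_mono[of "Suc i" j] S_mono[of "Suc j" i] that code_lo_less_hi[of y, where ?'a = rat]
      unfolding A_def by cases linarith+
  qed
  \<comment> \<open>If \<open>p\<close> were a proper prefix, then \<open>q\<close> without its last
    bit would still extend \<open>p\<close> and stay in the slot, against the maximality of
    \<open>q\<close>.\<close>
  have fits_prefix: "p = q" if "fits (bits_code p) i" "fits (bits_code q) j" "prefix p q" for p q i j
  proof (rule ccontr)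
    assume "p \<noteq> q"
    with that(3) obtain b q' where q: "q = q' @ [b]" and pre: "prefix p q'"
      by (cases q rule: rev_cases) (auto simp: prefix_snoc)
    have "i = j"
      using unique that(1,2) prefix_code_nested[OF that(3), where ?'a = rat] unfolding fits_def by blast
    have "A (bits_code q') j"
      using that(1) prefix_code_nested[OF pre, where ?'a = rat] unfolding fits_def A_def \<open>i = j\<close> by force
    moreover have "bits_code q div 2 = bits_code q'" unfolding q by simp
    ultimately show False using that(2) unfolding fits_def by simp
  qed
  have "effective (\<lambda>z. A (fst z) (snd z))"
    unfolding A_def S_def code_lo_def code_hi_def
    by (intro effective_intros effective_compose[OF w(1)])
  note A = effective_compose2[OF this]
  have R: "effective (\<lambda>z. R (fst z) (snd z))"
    unfolding R_def fits_def
    by (intro effective_intros effective_compose2[OF P] A)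
  obtain e where e: "\<And>x n. computes e [x] n \<longleftrightarrow> (\<exists>s. R s x) \<and> n = snd_nat (LEAST s. R s x)"
    using search_recf[OF R effective_snd_nat] by blast
  have "prefix_free_machine V"
    unfolding prefix_free_machine_def
  proof (intro conjI exI[of _ e] allI ballI impI)
    show "V p = Some n \<longleftrightarrow> computes e [bits_code p] n" for p n
      unfolding e V_def by auto
    fix p q assume "p \<in> dom V" "q \<in> dom V" "prefix p q"
    then show "p = q" using fits_prefix unfolding V_def R_def by (auto split: if_splits)
  qed
  then obtain c where c: "\<And>p n. V p = Some n \<Longrightarrow> \<exists>q. U q = Some n \<and> length q \<le> length p + c"
    using U unfolding optimal_machine_def by blast
  have "\<exists>n' q. P j n' \<and> U q = Some n' \<and> length q \<le> l + Suc c" if wj: "w j \<ge> (1/2) ^ l" and Pj: "P j n" for j l n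
  proof -
    \<comment> \<open>The slot has length at least 2^-l, hence contains a whole cell of the grid of
      size 2^-(l+1). The first grid cell that does not start before the slot is such a cell.\<close>
    define y where "y = nat \<lceil>2 ^ Suc l * (1 + S j)\<rceil>"
    have y: "2 ^ Suc l * (1 + S j) \<le> of_nat y" "of_nat y < 2 ^ Suc l * (1 + S j) + 1"
      using S_nonneg[of j] unfolding y_def by (auto simp: of_nat_nat ceiling_less_iff) linarith+
    have "1 \<le> 2 ^ l * w j" using wj by (simp add: power_divide field_simps)
    then have y': "of_nat y + 1 \<le> 2 ^ Suc l * (1 + S (Suc j))"
      using y(2) unfolding S_def by (simp add: algebra_simps)
    also have "\<dots> \<le> 2 ^ Suc l * 2"
      using w(3)[of "Suc j"] unfolding S_def by (intro mult_left_mono) auto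
    finally have "of_nat (y + 1) \<le> (of_nat (2 ^ Suc (Suc l)) :: rat)" by simp
    then have lt: "y < 2 ^ Suc (Suc l)" unfolding of_nat_le_iff by simp
    have "(2::rat) ^ Suc l * 1 \<le> 2 ^ Suc l * (1 + S j)" using S_nonneg[of j] by (intro mult_left_mono) auto
    then have "of_nat (2 ^ Suc l) \<le> (of_nat y :: rat)" using y(1) by (simp only: of_nat_power of_nat_numeral mult_1_right)
    then have "2 ^ Suc l \<le> y" unfolding of_nat_le_iff .
    with lt have "code_length y = Suc l" by (intro code_length_eqI)
    then have Ay: "A y j" using y(1) y'
      unfolding A_def code_lo_def code_hi_def by (simp add: power_divide field_simps)
    \<comment> \<open>The least code in the slot is maximal there, because its half is a smaller
      code. Being at most \<open>y\<close>, it is not longer than \<open>y\<close>.\<close>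
    define x where "x = (LEAST x. A x j)"
    have Ax: "A x j" unfolding x_def by (rule LeastI[of "\<lambda>x. A x j", OF Ay])
    then have x0: "x > 0" using S_nonneg[of j] unfolding A_def code_lo_def by (cases x) auto
    then have "\<not> A (x div 2) j" using not_less_Least[of "x div 2" "\<lambda>x. A x j"] unfolding x_def[symmetric] by simp
    with Ax have fits: "fits x j" unfolding fits_def by simp
    obtain p where p: "bits_code p = x" using bits_code_surj[OF x0] .
    have "x \<le> y" unfolding x_def by (rule Least_le[of "\<lambda>x. A x j", OF Ay])
    with lt have "x < 2 ^ Suc (Suc l)" by linarith
    then have len: "length p \<le> Suc l"
      unfolding code_length_bits_code[of p, symmetric] p code_length_def by (rule Least_le)
    have ex: "R (prod_encode (j, n)) x" using fits Pj unfolding R_def by simp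
    define s where "s = (LEAST s. R s x)"
    have "R s x" unfolding s_def by (rule LeastI[of "\<lambda>s. R s x", OF ex])
    \<comment> \<open>The search may find a value other than \<open>n\<close>, but only for the same
      request, since \<open>x\<close> determines its slot.\<close>
    then have "fst_nat s = j" "P (fst_nat s) (snd_nat s)"
      using unique[of x "fst_nat s" x j] fits unfolding R_def fits_def by auto
    moreover have "V p = Some (snd_nat s)" using ex unfolding V_def p s_def by auto
    ultimately show ?thesis using c len by fastforce
  qed
  then show ?thesis by blast
qed

lemma sum_half_powers: "(\<Sum>j<n. (1/2) ^ Suc j) = 1 - (1/2 :: 'a::field_char_0) ^ n"
  by (induction n) (simp_all add: algebra_simps)

section \<open>Attainment of \<open>KP\<close> and \<open>BP\<close>\<close>

text \<open>Each number \<open>j\<close> is requested with weight 2^-(j+1) and is the only value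
  permitted for its request. Hence the \<open>LEAST\<close> in \<open>KP\<close> ranges over a
  nonempty set.\<close>

lemma optimal_machine_surj:
  assumes "optimal_machine U"
  shows "\<exists>p. U p = Some n"
proof -
  have "effective (\<lambda>j. (1/2 :: rat) ^ Suc j)" "effective (\<lambda>z. snd z = (fst z :: nat))"
    by (intro effective_intros)+
  moreover have "(\<Sum>j<n. (1/2 :: rat) ^ Suc j) \<le> 1" for n unfolding sum_half_powers by simp
  ultimately obtain d where "\<forall>j l n. (1/2 :: rat) ^ Suc j \<ge> (1/2) ^ l \<and> n = j \<longrightarrow>
    (\<exists>n' q. n' = j \<and> U q = Some n' \<and> length q \<le> l + d)"
    using optimal_machine_serves_requests[OF assms, of "\<lambda>j. (1/2) ^ Suc j" "\<lambda>j n. n = j"] by auto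
  from this[rule_format, of "Suc n" n n] show ?thesis by auto
qed

lemma KP_le: "U p = Some n \<Longrightarrow> KP U n \<le> length p"
  unfolding KP_def by (rule Least_le) blast

lemma KP_attained:
  assumes "optimal_machine U"
  obtains p where "length p = KP U n" "U p = Some n"
proof -
  have "\<exists>l p. length p = l \<and> U p = Some n" using optimal_machine_surj[OF assms, of n] by blast
  from LeastI_ex[OF this] show ?thesis using that unfolding KP_def by blast
qed

text \<open>There are finitely many programs up to a given length, and each has at most one output.
  This bounds the numbers that \<open>BP\<close> has to exceed or equal.\<close>

lemma finite_KP_le:
  assumes "optimal_machine U"
  shows "finite {n. int (KP U n) \<le> k}"
proof (rule finite_subset)
  have "n \<in> (the \<circ> U) ` {p. set p \<subseteq> UNIV \<and> length p \<le> nat k}" if "int (KP U n) \<le> k" for n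
  proof -
    obtain p where "length p = KP U n" "U p = Some n" using KP_attained[OF assms] .
    with that show ?thesis by (intro image_eqI[of _ _ p]) auto
  qed
  then show "{n. int (KP U n) \<le> k} \<subseteq> (the \<circ> U) ` {p. set p \<subseteq> UNIV \<and> length p \<le> nat k}" by blast
qed (intro finite_imageI finite_lists_length_le finite)

text \<open>The integers are not well-ordered, so \<open>LEAST\<close> is handled by a shift to the
  natural numbers.\<close>

lemma int_Least_bounded_below:
  fixes P :: "int \<Rightarrow> bool"
  assumes "P N" "\<And>N. P N \<Longrightarrow> b \<le> N"
  shows "P (LEAST N. P N)" "P N' \<Longrightarrow> (LEAST N. P N) \<le> N'"
proof -
  let ?m = "LEAST m. P (b + int m)"
  have "P (b + int (nat (N - b)))" using assms by simp
  then have m: "P (b + int ?m)" by (rule LeastI)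
  have le: "b + int ?m \<le> N'" if "P N'" for N'
  proof -
    have "?m \<le> nat (N' - b)" using that assms(2)[OF that] by (intro Least_le) simp
    then show ?thesis using assms(2)[OF that] by simp
  qed
  from m le have least: "(LEAST N. P N) = b + int ?m" by (rule Least_equality)
  show "P (LEAST N. P N)" unfolding least by (rule m)
  show "(LEAST N. P N) \<le> N'" if "P N'" unfolding least using that by (rule le)
qed

lemma BP_properties:
  assumes "optimal_machine U"
  shows BP_ge: "int (KP U n) \<le> k \<Longrightarrow> int n \<le> BP U k"
    and BP_attained: "BP U k = int n \<Longrightarrow> int (KP U n) \<le> k"
proof -
  let ?P = "\<lambda>N. N \<ge> -1 \<and> (\<forall>n. int n > N \<longrightarrow> int (KP U n) > k)"
  obtain M where "\<forall>n\<in>{n. int (KP U n) \<le> k}. n < M"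
    using finite_KP_le[OF assms, of k] unfolding finite_nat_set_iff_bounded by blast
  then have ex: "?P (int M)" by (auto simp: not_less[symmetric])
  have P: "?P (BP U k)" unfolding BP_def
    by (rule int_Least_bounded_below(1)[where b = "-1" and P = ?P, OF ex]) blast
  have least: "BP U k \<le> N" if "?P N" for N unfolding BP_def
    by (rule int_Least_bounded_below(2)[where b = "-1" and P = ?P, OF ex _ that]) blast
  show "int n \<le> BP U k" if "int (KP U n) \<le> k" using P that by (meson not_le)
  show "int (KP U n) \<le> k" if "BP U k = int n"
  proof (rule ccontr)
    assume "\<not> int (KP U n) \<le> k"
    \<comment> \<open>Otherwise \<open>int n - 1\<close> would be a smaller bound; for
      \<open>n = 0\<close> it is the admissible value -1.\<close>
    then have "int (KP U n') > k" if "int n' > int n - 1" for n'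
      using P \<open>BP U k = int n\<close> that by (cases "n' = n") auto
    then have "?P (int n - 1)" by simp
    from least[OF this] that show False by simp
  qed
qed

section \<open>Modulus of convergence and Kraft's inequality\<close>

lemma modulus_spec:
  assumes "a \<longlonglongrightarrow> \<alpha>" "\<epsilon> > 0" "n > modulus a \<alpha> \<epsilon>"
  shows "\<bar>\<alpha> - a n\<bar> < \<epsilon>"
proof -
  from assms(1,2) obtain N where "\<forall>n\<ge>N. dist (a n) \<alpha> < \<epsilon>" unfolding lim_sequentially by blast
  then have "\<forall>n>N. \<bar>\<alpha> - a n\<bar> < \<epsilon>" by (auto simp: dist_real_def abs_minus_commute)
  then have "\<forall>n>modulus a \<alpha> \<epsilon>. \<bar>\<alpha> - a n\<bar> < \<epsilon>" unfolding modulus_def by (rule LeastI)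
  with assms(3) show ?thesis by blast
qed

lemma modulus_le: "(\<And>n. n > N \<Longrightarrow> \<bar>\<alpha> - a n\<bar> < \<epsilon>) \<Longrightarrow> modulus a \<alpha> \<epsilon> \<le> N"
  unfolding modulus_def by (rule Least_le) blast

text \<open>The dyadic intervals of the programs lie in \<open>[1, 2)\<close> and are disjoint, as
  an overlap would make one program a prefix of the other. The sum is therefore the measure of a
  subset of an interval of length 1.\<close>

lemma kraft_inequality:
  assumes "prefix_free_machine U"
  shows "(\<Sum>x. if x \<in> bits_code ` dom U then ennreal ((1/2) ^ code_length x) else 0) \<le> 1"
proof -
  let ?I = "\<lambda>x. if x \<in> bits_code ` dom U then {code_lo x..<code_hi x :: real} else {}"
  have disj: "disjoint_family ?I"
    unfolding disjoint_family_on_def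
  proof (intro ballI impI, rule ccontr)
    fix x y :: nat assume "x \<noteq> y" "?I x \<inter> ?I y \<noteq> {}"
    then have "x \<in> bits_code ` dom U" "y \<in> bits_code ` dom U" by (auto split: if_splits)
    then obtain p q where *: "x = bits_code p" "y = bits_code q" "p \<in> dom U" "q \<in> dom U" by blast
    moreover obtain z where "z \<in> ?I x" "z \<in> ?I y" using \<open>?I x \<inter> ?I y \<noteq> {}\<close> by blast
    then have "code_lo x \<le> z" "z < code_hi x" "code_lo y \<le> z" "z < (code_hi y :: real)"
      using \<open>x \<in> _\<close> \<open>y \<in> _\<close> by simp_all
    ultimately have "prefix p q \<or> prefix q p"
      using overlap_imp_prefix[of p q, where ?'a = real] overlap_imp_prefix[of q p, where ?'a = real]
        nat_le_linear[of "length p" "length q"] by force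
    with assms *(1-4) \<open>x \<noteq> y\<close> show False unfolding prefix_free_machine_def by metis
  qed
  have "(if x \<in> bits_code ` dom U then ennreal ((1/2) ^ code_length x) else 0) = emeasure lborel (?I x)" for x
    using code_hi_diff_lo[of x, where ?'a = real] code_lo_less_hi[of x, where ?'a = real] by simp
  then have "(\<Sum>x. if x \<in> bits_code ` dom U then ennreal ((1/2) ^ code_length x) else 0) =
      (\<Sum>x. emeasure lborel (?I x))" by simp
  also have "\<dots> = emeasure lborel (\<Union>x. ?I x)"
    by (rule suminf_emeasure[OF _ disj]) auto
  also have "\<dots> \<le> emeasure lborel {1..<2::real}"
  proof (rule emeasure_mono)
    have "{code_lo (bits_code p)..<code_hi (bits_code p) :: real} \<subseteq> {1..<2}" for p
      using code_bounds[of p, where ?'a = real] by auto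
    then have "?I x \<subseteq> {1..<2}" for x by auto
    then show "(\<Union>x. ?I x) \<subseteq> {1..<2}" by blast
  qed simp
  finally show ?thesis by simp
qed

section \<open>Series of computable non-negative rationals\<close>

locale computable_series =
  fixes r :: "nat \<Rightarrow> rat" and a :: "nat \<Rightarrow> real" and \<alpha> :: real
  assumes effective_terms: "effective r"
    and terms_nonneg: "r i \<ge> 0"
    and terms_sums: "(\<lambda>i. real_of_rat (r i)) sums \<alpha>"
    and a_eq: "a n = (\<Sum>i<n. real_of_rat (r i))"
begin

text \<open>The rational form of \<open>a\<close>, on which programs can operate.\<close>

definition partial_sum :: "nat \<Rightarrow> rat" where
  "partial_sum n = (\<Sum>i<n. r i)"

lemma of_rat_partial_sum [simp]: "real_of_rat (partial_sum n) = a n"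
  by (simp add: partial_sum_def a_eq of_rat_sum)

lemma effective_partial_sum: "effective f \<Longrightarrow> effective (\<lambda>x. partial_sum (f x))"
  unfolding partial_sum_def
  by (intro effective_sum_rat effective_compose[OF effective_terms] effective_fst effective_id)

lemma a_tendsto: "a \<longlonglongrightarrow> \<alpha>"
  using terms_sums unfolding sums_def a_eq[symmetric] .

lemma incseq_a: "incseq a"
  by (intro incseq_SucI) (simp add: a_eq terms_nonneg)

lemma a_le: "a n \<le> \<alpha>"
  by (rule incseq_le[OF incseq_a a_tendsto])

lemma partial_sum_0 [simp]: "partial_sum 0 = 0"
  by (simp add: partial_sum_def)

lemma a_nonneg: "a n \<ge> 0"
  by (simp add: a_eq sum_nonneg terms_nonneg)

section \<open>Randomness implies fast growth of the modulus\<close>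

lemma random_imp_modulus_gt_BP:
  assumes U: "optimal_machine U" and random: "martin_loef_random \<alpha>"
  shows "\<exists>c::int. \<forall>k::nat. int (modulus a \<alpha> (1 / 2 ^ k)) > BP U (int k - c)"
proof (rule ccontr)
  assume "\<not> ?thesis"
  then have bad: "\<exists>k::nat. int (modulus a \<alpha> (1 / 2 ^ k)) \<le> BP U (int k - c)" for c
    by (auto simp: not_less)
  have pfree: "prefix_free_machine U" using U unfolding optimal_machine_def by blast
  then obtain e where e: "\<And>p n. U p = Some n \<longleftrightarrow> computes e [bits_code p] n"
    unfolding prefix_free_machine_def by blast
  \<comment> \<open>The index \<open>k\<close> pairs the code of a program with a step bound. The
    code 0 belongs to no string and is excluded in \<open>ok\<close>.\<close>
  define v where "v k = eval_steps e (snd_nat k) [fst_nat k]" for k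
  define ok where "ok k \<longleftrightarrow> v k \<noteq> 0 \<and> fst_nat k \<noteq> 0" for k
  \<comment> \<open>The interval of a program has twice this length, so by Kraft's inequality the
    total length is at most 2^-n.\<close>
  define \<delta> where "\<delta> n x = (1/2 :: rat) ^ (code_length x + n + 1)" for n x
  \<comment> \<open>A nonzero \<open>v k\<close> is the output plus one, so the centre is the first
    partial sum strictly beyond the output, where the modulus bound applies. Before the program
    halts, both ends are 0 and the interval is empty.\<close>
  define lo where "lo n k = (if ok k then partial_sum (v k) - \<delta> n (fst_nat k) else 0)" for n k
  define hi where "hi n k = (if ok k then partial_sum (v k) + \<delta> n (fst_nat k) else 0)" for n k
  define G where "G n = (\<Union>k. {real_of_rat (lo n k)<..<real_of_rat (hi n k)})" for n
  have v: "effective f \<Longrightarrow> effective (\<lambda>x. v (f x))" for f :: "nat \<times> nat \<Rightarrow> nat"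
    unfolding v_def by (intro effective_compose2[OF effective_eval_steps] effective_intros)
  have "effective (\<lambda>z. lo (fst z) (snd z))" "effective (\<lambda>z. hi (fst z) (snd z))"
    unfolding lo_def hi_def ok_def \<delta>_def
    by (intro effective_intros effective_partial_sum v)+
  then have "uniformly_effectively_open G"
    unfolding uniformly_effectively_open_def computable_rat_seq2_iff G_def by blast
  moreover have "emeasure lborel (G n) \<le> ennreal ((1/2) ^ n)" for n
  proof -
    \<comment> \<open>All step bounds that suffice for a program give the same interval, so each
      program contributes its length only once.\<close>
    define H where "H x = (\<Union>s. {real_of_rat (lo n (prod_encode (x, s)))<..<real_of_rat (hi n (prod_encode (x, s)))})" for x
    have "G n \<subseteq> (\<Union>x. H x)"
    proof
      fix z assume "z \<in> G n"
      then obtain k where "z \<in> {real_of_rat (lo n k)<..<real_of_rat (hi n k)}" unfolding G_def by blast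
      then have "z \<in> H (fst_nat k)" unfolding H_def by (intro UN_I[of "snd_nat k"]) auto
      then show "z \<in> (\<Union>x. H x)" by blast
    qed
    then have "emeasure lborel (G n) \<le> emeasure lborel (\<Union>x. H x)"
      by (rule emeasure_mono) (auto simp: H_def)
    also have "\<dots> \<le> (\<Sum>x. emeasure lborel (H x))"
      by (rule emeasure_subadditive_countably) (auto simp: H_def)
    also have "\<dots> \<le> (\<Sum>x. ennreal ((1/2) ^ n) *
        (if x \<in> bits_code ` dom U then ennreal ((1/2) ^ code_length x) else 0))"
    proof (rule suminf_le)
      fix x
      show "emeasure lborel (H x) \<le> ennreal ((1/2) ^ n) *
        (if x \<in> bits_code ` dom U then ennreal ((1/2) ^ code_length x) else 0)"
      proof (cases "\<exists>s. ok (prod_encode (x, s))")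
        case True
        then obtain s y where s: "eval_steps e s [x] = Suc y" "x \<noteq> 0"
          unfolding ok_def v_def by (auto simp: not0_implies_Suc gr0_conv_Suc)
        obtain p where p: "bits_code p = x" using bits_code_surj s(2) by blast
        have Up: "U p = Some y" unfolding e p computes_iff_eval_steps using s(1) by blast
        have vs: "v (prod_encode (x, s)) = Suc y" if "ok (prod_encode (x, s))" for s
        proof -
          from that obtain y' where y': "eval_steps e s [x] = Suc y'" unfolding ok_def v_def
            by (auto simp: gr0_conv_Suc)
          then have "U p = Some y'" unfolding e p computes_iff_eval_steps by blast
          with Up y' show ?thesis by (simp add: v_def)
        qed
        let ?d = "(1/2 :: real) ^ (code_length x + n + 1)"
        have "{real_of_rat (lo n (prod_encode (x, s)))<..<real_of_rat (hi n (prod_encode (x, s)))}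
            \<subseteq> {a (Suc y) - ?d<..<a (Suc y) + ?d}" for s
          using vs[of s] unfolding lo_def hi_def \<delta>_def
          by (auto simp: of_rat_diff of_rat_add of_rat_power of_rat_divide simp del: power_Suc)
        then have "H x \<subseteq> {a (Suc y) - ?d<..<a (Suc y) + ?d}" unfolding H_def by blast
        then have "emeasure lborel (H x) \<le> emeasure lborel {a (Suc y) - ?d<..<a (Suc y) + ?d}"
          by (rule emeasure_mono) simp
        also have "\<dots> = ennreal (2 * ?d)" by simp
        also have "2 * ?d = (1/2) ^ n * (1/2) ^ code_length x" by (simp add: power_add)
        finally show ?thesis using Up p by (force simp: ennreal_mult image_iff)
      next
        case False
        then have "H x = {}" unfolding H_def lo_def hi_def by auto
        then show ?thesis by simp
      qed
    qed auto
    also have "\<dots> = ennreal ((1/2) ^ n) *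
        (\<Sum>x. if x \<in> bits_code ` dom U then ennreal ((1/2) ^ code_length x) else 0)"
      by (rule ennreal_suminf_cmult)
    also have "\<dots> \<le> ennreal ((1/2) ^ n) * 1"
      by (intro mult_left_mono kraft_inequality[OF pfree]) simp
    finally show ?thesis by simp
  qed
  ultimately have "martin_loef_test G" unfolding martin_loef_test_def by blast
  moreover have "\<alpha> \<in> G c" for c
  proof -
    obtain k where k: "int (modulus a \<alpha> (1 / 2 ^ k)) \<le> BP U (int k - int (Suc c))" using bad by blast
    \<comment> \<open>The modulus is nonnegative, which rules out the default value -1 of
      \<open>BP\<close>.\<close>
    then obtain n where n: "BP U (int k - int (Suc c)) = int n"
      by (metis nonneg_int_cases of_nat_0_le_iff order_trans)
    have "int (KP U n) \<le> int k - int (Suc c)" by (rule BP_attained[OF U n])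
    then have KP: "KP U n + c + 1 \<le> k" by linarith
    obtain p where p: "length p = KP U n" "U p = Some n" using KP_attained[OF U] .
    obtain s where s: "eval_steps e s [bits_code p] = Suc n"
      using p(2) unfolding e computes_iff_eval_steps by blast
    have "modulus a \<alpha> (1 / 2 ^ k) < Suc n" using k n by linarith
    then have "\<bar>\<alpha> - a (Suc n)\<bar> < 1 / 2 ^ k" by (intro modulus_spec[OF a_tendsto]) auto
    also have "1 / 2 ^ k = (1/2 :: real) ^ k" by (simp add: power_divide)
    \<comment> \<open>The constant \<open>Suc c\<close> was chosen to reach the radius of the
      shortest program for \<open>n\<close> in the set with index \<open>c\<close>.\<close>
    also have "\<dots> \<le> (1/2) ^ (KP U n + c + 1)" using KP by (intro power_decreasing) auto
    finally have close: "\<bar>\<alpha> - a (Suc n)\<bar> < (1/2) ^ (KP U n + c + 1)" .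
    have "bits_code p \<noteq> 0" using bits_code_bounds(1)[of p] by (metis not_le zero_less_power pos2)
    then have "\<alpha> \<in> {real_of_rat (lo c (prod_encode (bits_code p, s)))<..<real_of_rat (hi c (prod_encode (bits_code p, s)))}"
      using close s p(1) unfolding lo_def hi_def ok_def v_def \<delta>_def
      by (auto simp: of_rat_diff of_rat_add of_rat_power of_rat_divide simp del: power_Suc)
    then show ?thesis unfolding G_def by blast
  qed
  ultimately show False using random unfolding martin_loef_random_def by blast
qed

section \<open>Fast growth of the modulus implies the Solovay property\<close>

lemma modulus_gt_BP_imp_solovay:
  assumes U: "optimal_machine U" and m: "semimeasure m" "lower_semicomputable m"
    and growth: "\<forall>k::nat. int (modulus a \<alpha> (1 / 2 ^ k)) > BP U (int k - c0)"
  shows "solovay_property m r"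
proof (rule ccontr)
  assume "\<not> solovay_property m r"
  then have small: "finite {i. real_of_rat (r i) \<ge> \<epsilon> * m i}" if "\<epsilon> > 0" for \<epsilon>
    using that unfolding solovay_property_def by blast
  have m_nonneg: "\<And>i. m i \<ge> 0" and m_summable: "summable m" and m_le: "suminf m \<le> 1"
    using m(1) unfolding semimeasure_def by auto
  obtain q where q_eff: "effective (\<lambda>z. q (fst z) (snd z))"
    and q_mono: "\<And>i. incseq (q i)" and q_lim: "\<And>i. (\<lambda>s. real_of_rat (q i s)) \<longlonglongrightarrow> m i"
    using m(2) unfolding lower_semicomputable_def computable_rat_seq2_iff by blast
  \<comment> \<open>Lower approximations of a nonnegative value may be negative. Truncation at 0
    ensures that adding further terms does not decrease \<open>M\<close>.\<close>
  define Q where "Q i s = max 0 (q i s)" for i s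
  define M where "M t = (\<Sum>i<t. Q i t)" for t
  have Q_nonneg: "Q i s \<ge> 0" for i s unfolding Q_def by simp
  have Q_mono: "Q i s \<le> Q i t" if "s \<le> t" for i s t
    unfolding Q_def by (rule max.mono[OF order_refl incseqD[OF q_mono that]])
  have M_mono: "M s \<le> M t" if "s \<le> t" for s t
  proof -
    have "M s \<le> (\<Sum>i<s. Q i t)" unfolding M_def by (intro sum_mono Q_mono that)
    also have "\<dots> \<le> M t" unfolding M_def using that by (intro sum_mono2) (auto simp: Q_nonneg)
    finally show ?thesis .
  qed
  have of_rat_Q: "real_of_rat (Q i s) = max 0 (real_of_rat (q i s))" for i s
    unfolding Q_def max_def by simp
  have q_le: "real_of_rat (q i s) \<le> m i" for i s
  proof (rule incseq_le[OF _ q_lim])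
    show "incseq (\<lambda>s. real_of_rat (q i s))" using q_mono[of i] unfolding incseq_def by (simp add: of_rat_less_eq)
  qed
  then have Q_le: "real_of_rat (Q i s) \<le> m i" for i s
    unfolding of_rat_Q using m_nonneg by simp
  have Q_lim: "(\<lambda>s. real_of_rat (Q i s)) \<longlonglongrightarrow> m i" for i
    using tendsto_max[OF tendsto_const[of 0] q_lim[of i]] m_nonneg[of i] unfolding of_rat_Q by (simp add: max_def)
  have M_le_sum: "real_of_rat (M t) \<le> (\<Sum>i<t. m i)" for t
    unfolding M_def of_rat_sum by (intro sum_mono Q_le)
  have "(\<Sum>i<t. m i) \<le> 1" for t
    using sum_le_suminf[OF m_summable, of "{..<t}"] m_nonneg m_le by simp
  then have M_le_1: "M t \<le> 1" for t
    using M_le_sum[of t] order_trans[of "real_of_rat (M t)" _ 1] by (metis of_rat_1 of_rat_less_eq)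
  have M_nonneg: "M t \<ge> 0" for t unfolding M_def by (intro sum_nonneg Q_nonneg)
  have M_exceeds: "\<exists>t. real_of_rat (M t) > y" if y: "y < suminf m" for y
  proof -
    obtain n where n: "y < (\<Sum>i<n. m i)"
      using order_tendstoD(1)[OF summable_LIMSEQ[OF m_summable] y] eventually_happens by fastforce
    have "(\<lambda>t. \<Sum>i<n. real_of_rat (Q i t)) \<longlonglongrightarrow> (\<Sum>i<n. m i)" by (intro tendsto_sum Q_lim)
    from order_tendstoD(1)[OF this n] obtain t where t: "t \<ge> n" "y < (\<Sum>i<n. real_of_rat (Q i t))"
      using eventually_happens[OF eventually_conj[OF eventually_ge_at_top[of n]]] by fastforce
    have "(\<Sum>i<n. real_of_rat (Q i t)) \<le> real_of_rat (M t)"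
      unfolding M_def of_rat_sum using t(1) by (intro sum_mono2) (auto simp: Q_nonneg)
    with t(2) show ?thesis by (intro exI[of _ t]) linarith
  qed
  define \<delta> where "\<delta> t = M (Suc t) - M t" for t
  have \<delta>_nonneg: "\<delta> t \<ge> 0" for t unfolding \<delta>_def using M_mono[of t "Suc t"] by simp
  \<comment> \<open>The pointer for \<epsilon> = 4^-c. This choice makes the square root of
    \<epsilon> rational and the weights summable over all \<open>c\<close>.\<close>
  define h where "h c t = rec_nat 0 (\<lambda>t v. max (v + (1/4) ^ c * \<delta> t) (partial_sum (Suc t))) t" for c t
  have h_0: "\<And>c. h c 0 = 0"
    and h_Suc: "\<And>c t. h c (Suc t) = max (h c t + (1/4) ^ c * \<delta> t) (partial_sum (Suc t))"
    by (simp_all add: h_def)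
  \<comment> \<open>At time \<open>s\<close> the pointer is at or beyond
    \<open>partial_sum s\<close>, and afterwards it moves at least by 4^-c times the growth of
    \<open>M\<close>.\<close>
  have h_ge: "h c t \<ge> partial_sum s + (1/4) ^ c * (M t - M s)" if "s \<le> t" for c s t
    using that
  proof (induction t rule: dec_induct)
    case base
    show ?case by (cases s) (simp_all add: h_0 h_Suc)
  next
    case (step t)
    have "partial_sum s + (1/4) ^ c * (M (Suc t) - M s) =
        (partial_sum s + (1/4) ^ c * (M t - M s)) + (1/4) ^ c * \<delta> t"
      unfolding \<delta>_def by (simp add: algebra_simps)
    then show ?case using step.IH unfolding h_Suc by linarith
  qed
  have crossing: "\<exists>t. real_of_rat (h c t) > \<alpha>" for c
  proof -
    define \<epsilon> where "\<epsilon> = (1/4 :: real) ^ c"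
    have \<epsilon>: "\<epsilon> > 0" unfolding \<epsilon>_def by simp
    obtain N where N: "\<And>i. i \<ge> N \<Longrightarrow> real_of_rat (r i) < \<epsilon> * m i"
    proof -
      obtain N where "\<forall>i\<in>{i. real_of_rat (r i) \<ge> \<epsilon> * m i}. i < N"
        using small[OF \<epsilon>] unfolding finite_nat_set_iff_bounded by blast
      then show ?thesis using that[of N] by (auto simp: not_le[symmetric])
    qed
    have sums_m: "(\<lambda>i. \<epsilon> * m (i + N)) sums (\<epsilon> * (suminf m - (\<Sum>i<N. m i)))"
      using sums_split_initial_segment[OF summable_sums[OF m_summable], of N] by (rule sums_mult)
    have sums_r: "(\<lambda>i. real_of_rat (r (i + N))) sums (\<alpha> - a N)"
      using sums_split_initial_segment[OF terms_sums, of N] unfolding a_eq .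
    \<comment> \<open>From \<open>N\<close> on the terms are strictly below \<epsilon> times those
      of \<open>m\<close>. So the remaining distance to \<alpha> is less than \<epsilon> times the
      growth that \<open>M\<close> still has ahead.\<close>
    have "0 < (\<Sum>i. \<epsilon> * m (i + N) - real_of_rat (r (i + N)))"
      using sums_summable[OF sums_diff[OF sums_m sums_r]] N by (intro suminf_pos) auto
    also have "\<dots> = \<epsilon> * (suminf m - (\<Sum>i<N. m i)) - (\<alpha> - a N)"
      using sums_unique[OF sums_diff[OF sums_m sums_r]] by simp
    also have "\<dots> \<le> \<epsilon> * (suminf m - real_of_rat (M N)) - (\<alpha> - a N)"
      using M_le_sum[of N] \<epsilon> by simp
    finally have "real_of_rat (M N) + (\<alpha> - a N) / \<epsilon> < suminf m" using \<epsilon> by (simp add: field_simps)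
    from M_exceeds[OF this] obtain t where t: "real_of_rat (M N) + (\<alpha> - a N) / \<epsilon> < real_of_rat (M t)" by blast
    have "0 \<le> (\<alpha> - a N) / \<epsilon>" using a_le[of N] \<epsilon> by simp
    with t have "real_of_rat (M N) < real_of_rat (M t)" by linarith
    then have "M N < M t" unfolding of_rat_less .
    then have "N \<le> t" using M_mono[of t N] by linarith
    then have "real_of_rat (partial_sum N + (1/4) ^ c * (M t - M N)) \<le> real_of_rat (h c t)"
      unfolding of_rat_less_eq by (rule h_ge)
    then have "a N + \<epsilon> * (real_of_rat (M t) - real_of_rat (M N)) \<le> real_of_rat (h c t)"
      by (simp add: \<epsilon>_def of_rat_add of_rat_mult of_rat_diff of_rat_power of_rat_divide)
    moreover have "\<epsilon> * (real_of_rat (M t) - real_of_rat (M N)) > \<alpha> - a N"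
      using t \<epsilon> by (simp add: field_simps)
    ultimately show ?thesis by (intro exI[of _ t]) linarith
  qed
  have step: "\<exists>u. real_of_rat (h c u) \<le> \<alpha> \<and> \<alpha> < real_of_rat (h c u) + (1/4) ^ c * real_of_rat (\<delta> u)" for c
  proof -
    define t where "t = (LEAST t. real_of_rat (h c t) > \<alpha>)"
    have t: "real_of_rat (h c t) > \<alpha>" unfolding t_def by (rule LeastI_ex[OF crossing])
    have "\<alpha> \<ge> 0" using a_le[of 0] by (simp add: a_eq)
    with t obtain u where u: "t = Suc u" by (cases t) (auto simp: h_0)
    have "real_of_rat (h c u) \<le> \<alpha>"
      using not_less_Least[of u "\<lambda>t. real_of_rat (h c t) > \<alpha>"] u unfolding t_def[symmetric] by simp
    \<comment> \<open>A jump leads to a partial sum and cannot pass \<alpha>, so the crossing is due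
      to the move by 4^-c times the increment of \<open>M\<close>.\<close>
    moreover have "\<alpha> < real_of_rat (h c u + (1/4) ^ c * \<delta> u)"
      using t a_le[of "Suc u"] unfolding u h_Suc max_def by (auto split: if_splits)
    ultimately show ?thesis
      by (intro exI[of _ u]) (simp add: of_rat_add of_rat_mult of_rat_power of_rat_divide)
  qed
  \<comment> \<open>Request \<open>j\<close> encodes a parameter \<open>c\<close> and a step
    \<open>u\<close>. The increments of \<open>M\<close> add up to at most 1, and the factors
    2^-(c+1) do so over all \<open>c\<close>.\<close>
  define w where "w j = (1/2) ^ Suc (fst_nat j) * \<delta> (snd_nat j)" for j
  \<comment> \<open>Only a lower bound is imposed on the partial sum, which keeps the condition
    decidable. At the crossing step some \<open>n\<close> meets it because \<open>a\<close> tends to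
    \<alpha>.\<close>
  define P where "P j n \<longleftrightarrow> h (fst_nat j) (snd_nat j) - (1/4) ^ fst_nat j * \<delta> (snd_nat j) \<le> partial_sum n" for j n
  have Q_eff: "effective f \<Longrightarrow> effective g \<Longrightarrow> effective (\<lambda>x. Q (f x) (g x))" for f g :: "'z::numbered \<Rightarrow> nat"
    unfolding Q_def by (intro effective_max_rat effective_const effective_compose2[OF q_eff])
  have M_eff: "effective M"
    unfolding M_def by (intro effective_sum_rat effective_compose2[OF q_eff] effective_intros Q_eff)
  have \<delta>_eff: "effective \<delta>"
    unfolding \<delta>_def by (intro effective_intros effective_compose[OF M_eff])
  have h_eff: "effective (\<lambda>z. h (fst z) (snd z))"
    unfolding h_def by (intro effective_intros effective_compose[OF \<delta>_eff] effective_partial_sum)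
  have w_eff: "effective w"
    unfolding w_def by (intro effective_intros effective_compose[OF \<delta>_eff])
  have P_eff: "effective (\<lambda>z. P (fst z) (snd z))"
    unfolding P_def by (intro effective_intros effective_compose[OF \<delta>_eff] effective_partial_sum effective_compose2[OF h_eff])
  have w_nonneg: "w j \<ge> 0" for j unfolding w_def by (simp add: \<delta>_nonneg)
  have w_sum: "(\<Sum>j<n. w j) \<le> 1" for n
  proof -
    have "(\<Sum>j<n. w j) = (\<Sum>z\<in>prod_decode ` {..<n}. (1/2) ^ Suc (fst z) * \<delta> (snd z))"
      unfolding w_def by (subst sum.reindex[OF inj_prod_decode]) simp
    \<comment> \<open>Both components of a pair are at most its code, so the first \<open>n\<close>
      pairs lie in a square, over which the sum factors.\<close>
    also have "\<dots> \<le> (\<Sum>z\<in>{..<n} \<times> {..<n}. (1/2) ^ Suc (fst z) * \<delta> (snd z))"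
    proof (rule sum_mono2)
      have "z \<in> {..<n} \<times> {..<n}" if "j < n" "z = prod_decode j" for z j
        using that le_prod_encode_1[of "fst z" "snd z"] le_prod_encode_2[of "snd z" "fst z"]
        by (simp add: mem_Times_iff)
      then show "prod_decode ` {..<n} \<subseteq> {..<n} \<times> {..<n}" by blast
    qed (auto simp: \<delta>_nonneg)
    also have "\<dots> = (\<Sum>c<n. (1/2) ^ Suc c) * (\<Sum>u<n. \<delta> u)"
      by (simp add: sum_product sum.cartesian_product case_prod_unfold)
    also have "(\<Sum>u<n. \<delta> u) = M n - M 0" unfolding \<delta>_def by (rule sum_lessThan_telescope)
    also have "(\<Sum>c<n. (1/2) ^ Suc c) * (M n - M 0) \<le> 1 * 1"
      using M_le_1[of n] M_nonneg[of 0] M_mono[of 0 n] by (intro mult_mono) (simp_all add: sum_half_powers del: power_Suc)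
    finally show ?thesis by simp
  qed
  obtain d where d: "\<And>j l n. w j \<ge> (1/2) ^ l \<Longrightarrow> P j n \<Longrightarrow>
      \<exists>n' q. P j n' \<and> U q = Some n' \<and> length q \<le> l + d"
    using optimal_machine_serves_requests[OF U w_eff w_nonneg w_sum P_eff] by blast
  \<comment> \<open>The distance from \<alpha> will be below 8 * 2^-(l+c) = 2^-k for
    \<open>k = l + c - 3\<close>, while the complexity is at most \<open>l + d\<close>. This is at
    most \<open>k - c0\<close> as soon as \<open>c\<close> is at least
    \<open>d + 3 + c0\<close>.\<close>
  define c where "c = d + 3 + nat \<bar>c0\<bar>"
  obtain u where u: "real_of_rat (h c u) \<le> \<alpha>" "\<alpha> < real_of_rat (h c u) + (1/4) ^ c * real_of_rat (\<delta> u)"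
    using step by blast
  define j where "j = prod_encode (c, u)"
  have wj: "w j = (1/2) ^ Suc c * \<delta> u" unfolding w_def j_def by simp
  have "(1/4 :: real) ^ c * real_of_rat (\<delta> u) > 0" using u by linarith
  then have \<delta>_pos: "\<delta> u > 0" by (simp add: zero_less_mult_iff)
  then have w_pos: "w j > 0" unfolding wj by simp
  have w_le_1: "w j \<le> 1"
    using w_sum[of "Suc j"] sum_nonneg[of "{..<j}" w] w_nonneg by simp
  \<comment> \<open>This rounding places \<open>w j\<close> between 2^-l and 2 * 2^-l; for
    \<open>l = 0\<close> the upper bound comes from \<open>w j \<le> 1\<close>.\<close>
  define l where "l = (LEAST l. (1/2) ^ l \<le> w j)"
  obtain l0 where "(1/2 :: real) ^ l0 < real_of_rat (w j)"
    using real_arch_pow_inv[of "real_of_rat (w j)" "1/2"] w_pos by auto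
  then have "real_of_rat ((1/2) ^ l0) \<le> real_of_rat (w j)" by (simp add: of_rat_power of_rat_divide)
  then have "\<exists>l. (1/2) ^ l \<le> w j" unfolding of_rat_less_eq by blast
  then have l: "(1/2) ^ l \<le> w j" unfolding l_def by (rule LeastI_ex)
  have l': "w j < 2 * (1/2) ^ l"
  proof (cases l)
    case 0
    with w_le_1 show ?thesis by simp
  next
    case (Suc l')
    then show ?thesis using not_less_Least[of l' "\<lambda>l. (1/2) ^ l \<le> w j"] unfolding l_def[symmetric] by simp
  qed
  have P_iff: "P j n \<longleftrightarrow> real_of_rat (h c u) - (1/4) ^ c * real_of_rat (\<delta> u) \<le> a n" for n
  proof -
    have "P j n \<longleftrightarrow> real_of_rat (h c u - (1/4) ^ c * \<delta> u) \<le> real_of_rat (partial_sum n)"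
      unfolding P_def j_def of_rat_less_eq by simp
    then show ?thesis by (simp add: of_rat_diff of_rat_mult of_rat_power of_rat_divide)
  qed
  have "real_of_rat (h c u) - (1/4) ^ c * real_of_rat (\<delta> u) < \<alpha>"
    using u(1) \<open>(1/4) ^ c * real_of_rat (\<delta> u) > 0\<close> by linarith
  from order_tendstoD(1)[OF a_tendsto this]
  obtain n where "real_of_rat (h c u) - (1/4) ^ c * real_of_rat (\<delta> u) < a n"
    by (rule eventually_happens'[OF sequentially_bot, THEN exE])
  then have "P j n" unfolding P_iff by simp
  from d[OF l this] obtain n' p where n': "P j n'" "U p = Some n'" "length p \<le> l + d" by blast
  define k where "k = l + c - 3"
  have k: "k + 3 = l + c" unfolding k_def c_def by simp
  have "modulus a \<alpha> (1 / 2 ^ k) \<le> n'"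
  proof (rule modulus_le)
    fix n assume "n > n'"
    then have "a n' \<le> a n" using incseqD[OF incseq_a] by simp
    \<comment> \<open>One move separates \<alpha> from the start of the step, and \<open>P\<close>
      allows the partial sum to lie one more move below that start.\<close>
    then have "\<alpha> - a n < 2 * ((1/4) ^ c * real_of_rat (\<delta> u))"
      using u(2) n'(1) unfolding P_iff by linarith
    also have "\<dots> = 4 * (1/2) ^ c * real_of_rat (w j)"
    proof -
      have "(1/4 :: real) ^ c = (1/2) ^ c * (1/2) ^ c" by (simp flip: power_mult_distrib)
      then show ?thesis unfolding wj by (simp add: of_rat_mult of_rat_power of_rat_divide)
    qed
    also have "real_of_rat (w j) < 2 * (1/2) ^ l"
    proof -
      have "real_of_rat (w j) < real_of_rat (2 * (1/2) ^ l)" using l' unfolding of_rat_less .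
      then show ?thesis by (simp add: of_rat_mult of_rat_power of_rat_divide)
    qed
    then have "4 * (1/2) ^ c * real_of_rat (w j) < 4 * (1/2) ^ c * (2 * (1/2) ^ l)" by simp
    also have "\<dots> = 8 * (1/2) ^ (k + 3)" unfolding k by (simp add: power_add)
    also have "\<dots> = 1 / 2 ^ k" by (simp add: power_add power_divide)
    finally show "\<bar>\<alpha> - a n\<bar> < 1 / 2 ^ k" using a_le[of n] by simp
  qed
  moreover have "int (KP U n') \<le> int k - c0"
    using KP_le[of U, OF n'(2)] n'(3) k unfolding c_def by linarith
  from BP_ge[OF U this] have "int n' \<le> BP U (int k - c0)" .
  ultimately show False using growth[rule_format, of k] by linarith
qed

end

section \<open>Domination and positivity of the universal semimeasure\<close>

lemma universal_semimeasure_dominates: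
  assumes "universal_semimeasure m" "semimeasure m'" "lower_semicomputable m'"
  shows "\<exists>C>0. \<forall>i. m' i \<le> C * m i"
proof -
  from assms(1) have "semimeasure m' \<and> lower_semicomputable m' \<longrightarrow> (\<exists>C>0. \<forall>i. m' i \<le> C * m i)"
    unfolding universal_semimeasure_def by (elim conjE allE[of _ m'])
  with assms(2,3) show ?thesis by blast
qed

text \<open>Domination of the everywhere positive semimeasure 2^-(i+1).\<close>

lemma universal_semimeasure_pos:
  assumes "universal_semimeasure m"
  shows "m i > 0"
proof -
  let ?g = "\<lambda>i. (1/2 :: real) ^ Suc i"
  have "semimeasure ?g"
    using power_half_series unfolding semimeasure_def by (auto simp: sums_iff)
  moreover have "lower_semicomputable ?g"
    unfolding lower_semicomputable_def computable_rat_seq2_iff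
  proof (intro exI[of _ "\<lambda>i s. (1/2) ^ Suc i"] conjI allI)
    show "effective (\<lambda>z. (1/2 :: rat) ^ Suc (fst z))" by (intro effective_intros)
    show "(\<lambda>s. real_of_rat ((1/2) ^ Suc i)) \<longlonglongrightarrow> (1/2) ^ Suc i" for i
      by (simp add: of_rat_power of_rat_divide of_rat_mult)
  qed (simp add: incseq_def)
  ultimately obtain C where C: "C > 0" "\<And>i. ?g i \<le> C * m i"
    using universal_semimeasure_dominates[OF assms] by blast
  then have "0 < C * m i" using less_le_trans[OF _ C(2)[of i], of 0] by simp
  with \<open>C > 0\<close> show ?thesis by (simp add: zero_less_mult_iff)
qed

section \<open>The Solovay property implies randomness\<close>

context computable_series
begin

lemma solovay_imp_random:
  assumes m: "universal_semimeasure m" and solovay: "solovay_property m r"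
  shows "martin_loef_random \<alpha>"
proof (rule ccontr)
  assume "\<not> martin_loef_random \<alpha>"
  then obtain G where test: "martin_loef_test G" and \<alpha>_in: "\<And>n. \<alpha> \<in> G n"
    unfolding martin_loef_random_def by blast
  then have G_small: "\<And>n. emeasure lborel (G n) \<le> ennreal ((1/2) ^ n)"
    unfolding martin_loef_test_def by blast
  have "uniformly_effectively_open G" using test unfolding martin_loef_test_def by blast
  then obtain lo up where lo_up: "computable_rat_seq2 lo" "computable_rat_seq2 up"
    and "\<forall>n. G n = (\<Union>k. {real_of_rat (lo n k)<..<real_of_rat (up n k)})"
    unfolding uniformly_effectively_open_def by blast
  then have G: "\<And>n. G n = (\<Union>k. {real_of_rat (lo n k)<..<real_of_rat (up n k)})" by blast
  note lo = lo_up(1)[unfolded computable_rat_seq2_iff] and up = lo_up(2)[unfolded computable_rat_seq2_iff]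
  have G_sets: "G n \<in> sets lborel" for n unfolding G by auto
  \<comment> \<open>Grid cells up to the integer \<open>A\<close> cover all steps of the series,
    which keeps the counts below finite.\<close>
  obtain A :: nat where A: "\<alpha> \<le> real A" using real_arch_simple by blast
  \<comment> \<open>Cell \<open>j\<close> of the grid of size 2^-s is counted if it lies in the step
    from \<open>a i\<close> to \<open>a (Suc i)\<close> and inside a single one of the first
    \<open>s\<close> intervals of the test set.\<close>
  define cond where "cond c i s j \<longleftrightarrow> (\<exists>k<s.
      partial_sum i * 2 ^ s \<le> of_nat j \<and> of_nat j + 1 \<le> partial_sum (Suc i) * 2 ^ s \<and>
      lo (2 * c + 1) k * 2 ^ s < of_nat j \<and> of_nat j + 1 < up (2 * c + 1) k * 2 ^ s)" for c i s j
  define cnt where "cnt c i s = (\<Sum>j<A * 2 ^ s. if cond c i s j then (1/2 :: rat) ^ s else 0)" for c i s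
  \<comment> \<open>The test set with index \<open>2 * c + 1\<close> has measure at most 2^-(2c+1).
    After multiplication by 2^c there remains 2^-(c+1), so the total is at most 1.\<close>
  define q where "q i s = (\<Sum>c<s. 2 ^ c * cnt c i s)" for i s
  have q_eff: "effective (\<lambda>z. q (fst z) (snd z))"
    unfolding q_def cnt_def cond_def
    by (intro effective_intros effective_partial_sum effective_compose2[OF lo] effective_compose2[OF up])
  define cell where "cell s j = {real j / 2 ^ s..<(real j + 1) / 2 ^ s}" for s j
  have cell_iff: "x \<in> cell s j \<longleftrightarrow> real j \<le> x * 2 ^ s \<and> x * 2 ^ s < real j + 1" for x s j
    unfolding cell_def by (simp add: pos_divide_le_eq pos_less_divide_eq)
  define E where "E c i s = (\<Union>j\<in>{j. j < A * 2 ^ s \<and> cond c i s j}. cell s j)" for c i s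
  have E_sets: "E c i s \<in> sets lborel" for c i s
    unfolding E_def cell_def by (intro sets.finite_UN) auto
  have cond_real: "cond c i s j \<longleftrightarrow> (\<exists>k<s.
      a i * 2 ^ s \<le> real j \<and> real j + 1 \<le> a (Suc i) * 2 ^ s \<and>
      real_of_rat (lo (2 * c + 1) k) * 2 ^ s < real j \<and> real j + 1 < real_of_rat (up (2 * c + 1) k) * 2 ^ s)" for c i s j
  proof -
    have "u * 2 ^ s \<le> of_nat j \<longleftrightarrow> real_of_rat u * 2 ^ s \<le> real j"
      "of_nat j + 1 \<le> u * 2 ^ s \<longleftrightarrow> real j + 1 \<le> real_of_rat u * 2 ^ s"
      "u * 2 ^ s < of_nat j \<longleftrightarrow> real_of_rat u * 2 ^ s < real j"
      "of_nat j + 1 < u * 2 ^ s \<longleftrightarrow> real j + 1 < real_of_rat u * 2 ^ s" for u :: rat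
      using of_rat_less_eq[of "u * 2 ^ s" "of_nat j", where ?'a = real]
        of_rat_less_eq[of "of_nat j + 1" "u * 2 ^ s", where ?'a = real]
        of_rat_less[of "u * 2 ^ s" "of_nat j", where ?'a = real]
        of_rat_less[of "of_nat j + 1" "u * 2 ^ s", where ?'a = real]
      by (simp_all add: of_rat_mult of_rat_power of_rat_add)
    then show ?thesis unfolding cond_def of_rat_partial_sum[symmetric] by simp
  qed
  have cnt_nonneg: "cnt c i s \<ge> 0" for c i s unfolding cnt_def by (intro sum_nonneg) auto
  have emeasure_E: "emeasure lborel (E c i s) = ennreal (real_of_rat (cnt c i s))" for c i s
  proof -
    let ?J = "{j. j < A * 2 ^ s \<and> cond c i s j}"
    have disj: "disjoint_family_on (cell s) ?J"
      unfolding disjoint_family_on_def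
    proof (intro ballI impI, rule ccontr)
      fix j k :: nat assume "j \<noteq> k" "cell s j \<inter> cell s k \<noteq> {}"
      then obtain x where "x \<in> cell s j" "x \<in> cell s k" by blast
      with \<open>j \<noteq> k\<close> show False unfolding cell_iff by linarith
    qed
    have "emeasure lborel (E c i s) = (\<Sum>j\<in>?J. emeasure lborel (cell s j))"
      unfolding E_def by (rule sum_emeasure[symmetric, OF _ disj]) (auto simp: cell_def)
    also have "\<dots> = (\<Sum>j\<in>?J. ennreal ((1/2) ^ s))"
      by (intro sum.cong refl) (simp add: cell_def power_divide divide_simps del: sum.cong flip: diff_divide_distrib)
    also have "\<dots> = ennreal (\<Sum>j\<in>?J. (1/2) ^ s)" by (rule sum_ennreal) simp
    also have "(\<Sum>j\<in>?J. (1/2) ^ s) = (\<Sum>j<A * 2 ^ s. if cond c i s j then (1/2 :: real) ^ s else 0)"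
      by (subst sum.If_cases) (auto intro: sum.cong simp: Collect_conj_eq lessThan_def)
    also have "\<dots> = real_of_rat (cnt c i s)"
      unfolding cnt_def of_rat_sum by (intro sum.cong) (auto simp: of_rat_power of_rat_divide)
    finally show ?thesis .
  qed
  have E_subset: "E c i s \<subseteq> G (2 * c + 1) \<inter> {a i..<a (Suc i)}" for c i s
  proof
    fix x assume "x \<in> E c i s"
    then obtain j k where *: "real j \<le> x * 2 ^ s" "x * 2 ^ s < real j + 1"
      "a i * 2 ^ s \<le> real j" "real j + 1 \<le> a (Suc i) * 2 ^ s"
      "real_of_rat (lo (2 * c + 1) k) * 2 ^ s < real j" "real j + 1 < real_of_rat (up (2 * c + 1) k) * 2 ^ s"
      unfolding E_def cond_real by (auto simp: cell_iff)
    have "a i * 2 ^ s \<le> x * 2 ^ s" "x * 2 ^ s < a (Suc i) * 2 ^ s"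
      "real_of_rat (lo (2 * c + 1) k) * 2 ^ s < x * 2 ^ s" "x * 2 ^ s < real_of_rat (up (2 * c + 1) k) * 2 ^ s"
      using * by linarith+
    then show "x \<in> G (2 * c + 1) \<inter> {a i..<a (Suc i)}"
      unfolding G by auto
  qed
  have E_mono: "E c i s \<subseteq> E c i (Suc s)" for c i s
  proof
    fix x assume "x \<in> E c i s"
    then obtain j k where j: "j < A * 2 ^ s" "real j \<le> x * 2 ^ s" "x * 2 ^ s < real j + 1" "k < s"
      "a i * 2 ^ s \<le> real j" "real j + 1 \<le> a (Suc i) * 2 ^ s"
      "real_of_rat (lo (2 * c + 1) k) * 2 ^ s < real j" "real j + 1 < real_of_rat (up (2 * c + 1) k) * 2 ^ s"
      unfolding E_def cond_real by (auto simp: cell_iff)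
    \<comment> \<open>The half of cell \<open>j\<close> that contains \<open>x\<close>; both halves
      inherit the condition on the finer grid.\<close>
    define j' where "j' = (if x * 2 ^ Suc s < 2 * real j + 1 then 2 * j else 2 * j + 1)"
    have "j' < A * 2 ^ Suc s" using j(1) unfolding j'_def by auto
    moreover have "x \<in> cell (Suc s) j'" using j(2,3) unfolding cell_iff j'_def by auto
    moreover have "cond c i (Suc s) j'" unfolding cond_real
      using j(4-) by (intro exI[of _ k]) (auto simp: j'_def)
    ultimately show "x \<in> E c i (Suc s)" unfolding E_def by blast
  qed
  \<comment> \<open>Counts on different grids are compared through the measures of the regions that
    they describe.\<close>
  have cnt_mono: "cnt c i s \<le> cnt c i (Suc s)" for c i s
  proof -
    have "emeasure lborel (E c i s) \<le> emeasure lborel (E c i (Suc s))"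
      by (rule emeasure_mono[OF E_mono E_sets])
    then show ?thesis unfolding emeasure_E using cnt_nonneg by (simp add: of_rat_less_eq)
  qed
  have cnt_sum: "(\<Sum>i<n. real_of_rat (cnt c i s)) \<le> (1/2) ^ (2 * c + 1)" for c n s
  proof -
    have disj: "disjoint_family_on (\<lambda>i. E c i s) {..<n}"
      unfolding disjoint_family_on_def
    proof (intro ballI impI, rule ccontr)
      fix i k :: nat assume "i \<noteq> k" "E c i s \<inter> E c k s \<noteq> {}"
      then obtain x where "x \<in> E c i s" "x \<in> E c k s" by blast
      then have "x \<in> {a i..<a (Suc i)}" "x \<in> {a k..<a (Suc k)}" using E_subset by blast+
      then have x: "a i \<le> x" "x < a (Suc i)" "a k \<le> x" "x < a (Suc k)" by simp_all
      from \<open>i \<noteq> k\<close> consider "Suc i \<le> k" | "Suc k \<le> i" by linarith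
      then show False using incseqD[OF incseq_a, of "Suc i" k] incseqD[OF incseq_a, of "Suc k" i] x
        by cases auto
    qed
    have "ennreal (\<Sum>i<n. real_of_rat (cnt c i s)) = (\<Sum>i<n. emeasure lborel (E c i s))"
      unfolding emeasure_E by (rule sum_ennreal[symmetric]) (simp add: cnt_nonneg)
    also have "\<dots> = emeasure lborel (\<Union>i<n. E c i s)"
      by (rule sum_emeasure[OF _ disj]) (use E_sets in auto)
    also have "\<dots> \<le> emeasure lborel (G (2 * c + 1))"
      using E_subset by (intro emeasure_mono G_sets) blast
    also have "\<dots> \<le> ennreal ((1/2) ^ (2 * c + 1))" by (rule G_small)
    finally show ?thesis by (simp add: ennreal_le_iff del: power_Suc)
  qed
  have q_nonneg: "q i s \<ge> 0" for i s unfolding q_def by (intro sum_nonneg) (simp add: cnt_nonneg)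
  have q_mono: "incseq (q i)" for i
  proof (rule incseq_SucI)
    fix s
    have "q i s \<le> (\<Sum>c<s. 2 ^ c * cnt c i (Suc s))"
      unfolding q_def by (intro sum_mono mult_left_mono cnt_mono) simp
    also have "\<dots> \<le> q i (Suc s)" unfolding q_def by (simp add: cnt_nonneg)
    finally show "q i s \<le> q i (Suc s)" .
  qed
  have q_sum: "(\<Sum>i<n. real_of_rat (q i s)) \<le> 1" for n s
  proof -
    have "(\<Sum>i<n. real_of_rat (q i s)) = (\<Sum>c<s. 2 ^ c * (\<Sum>i<n. real_of_rat (cnt c i s)))"
      unfolding q_def of_rat_sum of_rat_mult sum_distrib_left
      by (subst sum.swap) (simp add: of_rat_power)
    also have "\<dots> \<le> (\<Sum>c<s. 2 ^ c * (1/2) ^ (2 * c + 1))"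
      by (intro sum_mono mult_left_mono cnt_sum) simp
    also have "\<dots> = (\<Sum>c<s. (1/2) ^ Suc c)"
    proof (intro sum.cong refl)
      fix c
      have "2 * c + 1 = c + Suc c" by simp
      then have "(2::real) ^ c * (1/2) ^ (2 * c + 1) = (2 * (1/2)) ^ c * (1/2) ^ Suc c"
        by (simp only: power_add power_mult_distrib mult.assoc)
      then show "(2::real) ^ c * (1/2) ^ (2 * c + 1) = (1/2) ^ Suc c" by simp
    qed
    also have "\<dots> \<le> 1" unfolding sum_half_powers by simp
    finally show ?thesis .
  qed
  have q_le_1: "real_of_rat (q i s) \<le> 1" for i s
  proof -
    have "real_of_rat (q i s) \<le> (\<Sum>i<Suc i. real_of_rat (q i s))"
      by (rule member_le_sum) (simp_all add: q_nonneg)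
    also have "\<dots> \<le> 1" by (rule q_sum)
    finally show ?thesis .
  qed
  have q_real_mono: "incseq (\<lambda>s. real_of_rat (q i s))" for i
    using q_mono[of i] unfolding incseq_def by (simp add: of_rat_less_eq)
  have "\<exists>L. (\<lambda>s. real_of_rat (q i s)) \<longlonglongrightarrow> L" for i
    using incseq_convergent[OF q_real_mono, of i 1] q_le_1 by blast
  then obtain m' where m': "\<And>i. (\<lambda>s. real_of_rat (q i s)) \<longlonglongrightarrow> m' i" by metis
  have m'_nonneg: "m' i \<ge> 0" for i
    by (rule LIMSEQ_le_const[OF m']) (auto simp: q_nonneg)
  have m'_sum: "(\<Sum>i<n. m' i) \<le> 1" for n
    by (rule LIMSEQ_le_const2[OF tendsto_sum[OF m']]) (use q_sum in auto)
  then have "summable m'" using m'_nonneg by (intro summableI_nonneg_bounded)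
  then have "semimeasure m'" unfolding semimeasure_def
    using m'_nonneg m'_sum suminf_le_const by blast
  moreover have "lower_semicomputable m'"
    unfolding lower_semicomputable_def computable_rat_seq2_iff using q_eff q_mono m' by blast
  ultimately obtain C where C: "C > 0" "\<And>i. m' i \<le> C * m i"
    using universal_semimeasure_dominates[OF m] by blast
  have large: "\<exists>I. \<forall>i\<ge>I. 2 ^ c * real_of_rat (r i) \<le> m' i" for c
  proof -
    \<comment> \<open>A single interval of the test set contains \<alpha>, and hence every
      sufficiently late step of the series, since these steps accumulate at \<alpha> from
      below.\<close>
    obtain k where k: "real_of_rat (lo (2 * c + 1) k) < \<alpha>" "\<alpha> < real_of_rat (up (2 * c + 1) k)"
      using \<alpha>_in[of "2 * c + 1"] unfolding G by auto
    obtain I where I: "\<And>i. i \<ge> I \<Longrightarrow> real_of_rat (lo (2 * c + 1) k) < a i"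
      using order_tendstoD(1)[OF a_tendsto k(1)] unfolding eventually_sequentially by blast
    have "2 ^ c * real_of_rat (r i) \<le> m' i" if "i \<ge> I" for i
    proof -
      have "2 ^ c * (real_of_rat (r i) - 2 * (1/2) ^ s) \<le> real_of_rat (q i s)" if s: "s \<ge> Suc (max k c)" for s
      proof -
        \<comment> \<open>Only a margin of one cell at each end can be missed. The bound on
          \<open>s\<close> ensures that interval \<open>k\<close> and parameter \<open>c\<close> are
          already taken into account.\<close>
        let ?B = "{a i + (1/2) ^ s..<a (Suc i) - (1/2) ^ s}"
        have "?B \<subseteq> E c i s"
        proof
          fix x assume "x \<in> ?B"
          then have "(a i + (1/2) ^ s) * 2 ^ s \<le> x * 2 ^ s" "x * 2 ^ s < (a (Suc i) - (1/2) ^ s) * 2 ^ s"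
            by auto
          then have x: "a i * 2 ^ s + 1 \<le> x * 2 ^ s" "x * 2 ^ s < a (Suc i) * 2 ^ s - 1"
            by (simp_all add: algebra_simps power_divide)
          have "0 \<le> a i * 2 ^ s" using a_nonneg[of i] by simp
          define j where "j = nat \<lfloor>x * 2 ^ s\<rfloor>"
          have j: "real j \<le> x * 2 ^ s" "x * 2 ^ s < real j + 1"
            using x(1) \<open>0 \<le> a i * 2 ^ s\<close> unfolding j_def by linarith+
          have "a (Suc i) * 2 ^ s \<le> \<alpha> * 2 ^ s" using a_le[of "Suc i"] by simp
          moreover have "\<alpha> * 2 ^ s < real_of_rat (up (2 * c + 1) k) * 2 ^ s" using k(2) by simp
          moreover have "real_of_rat (lo (2 * c + 1) k) * 2 ^ s < a i * 2 ^ s" using I[OF \<open>i \<ge> I\<close>] by simp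
          ultimately have "a i * 2 ^ s \<le> real j" "real j + 1 \<le> a (Suc i) * 2 ^ s"
            "real_of_rat (lo (2 * c + 1) k) * 2 ^ s < real j"
            "real j + 1 < real_of_rat (up (2 * c + 1) k) * 2 ^ s"
            using x j by linarith+
          moreover have "k < s" using s by simp
          ultimately have "cond c i s j" unfolding cond_real by blast
          moreover have "\<alpha> * 2 ^ s \<le> real A * 2 ^ s" using A by simp
          then have "real j < real A * 2 ^ s"
            using j x \<open>a (Suc i) * 2 ^ s \<le> \<alpha> * 2 ^ s\<close> by linarith
          then have "real j < real (A * 2 ^ s)" by simp
          then have "j < A * 2 ^ s" unfolding of_nat_less_iff .
          ultimately show "x \<in> E c i s" unfolding E_def using j by (auto simp: cell_iff)
        qed
        then have "emeasure lborel ?B \<le> emeasure lborel (E c i s)" by (rule emeasure_mono[OF _ E_sets])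
        then have "emeasure lborel ?B \<le> ennreal (real_of_rat (cnt c i s))" unfolding emeasure_E .
        moreover have "a (Suc i) - a i = real_of_rat (r i)" by (simp add: a_eq)
        \<comment> \<open>A step shorter than two cells makes the left side negative, and then the
          count being nonnegative suffices.\<close>
        ultimately have "real_of_rat (r i) - 2 * (1/2) ^ s \<le> real_of_rat (cnt c i s)"
          using cnt_nonneg[of c i s]
          by (cases "a i + (1/2) ^ s \<le> a (Suc i) - (1/2) ^ s") (auto simp: ennreal_le_iff not_le intro: order_trans[of _ 0])
        then have "2 ^ c * (real_of_rat (r i) - 2 * (1/2) ^ s) \<le> 2 ^ c * real_of_rat (cnt c i s)" by simp
        also have "\<dots> = real_of_rat (2 ^ c * cnt c i s)" by (simp add: of_rat_mult of_rat_power)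
        also have "\<dots> \<le> real_of_rat (q i s)"
          unfolding of_rat_less_eq q_def using s
          by (intro member_le_sum[of c "{..<s}" "\<lambda>c. 2 ^ c * cnt c i s"]) (auto simp: cnt_nonneg)
        finally show ?thesis .
      qed
      moreover have "(\<lambda>s. 2 ^ c * (real_of_rat (r i) - 2 * (1/2) ^ s)) \<longlonglongrightarrow> 2 ^ c * (real_of_rat (r i) - 2 * 0)"
        by (intro tendsto_intros LIMSEQ_realpow_zero) auto
      ultimately have "2 ^ c * (real_of_rat (r i) - 2 * 0) \<le> m' i"
        using m' by (intro LIMSEQ_le[of _ _ "\<lambda>s. real_of_rat (q i s)"]) blast+
      then show ?thesis by simp
    qed
    then show ?thesis by blast
  qed
  obtain \<epsilon> where \<epsilon>: "\<epsilon> > 0" "infinite {i. real_of_rat (r i) \<ge> \<epsilon> * m i}"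
    using solovay unfolding solovay_property_def by blast
  \<comment> \<open>With this \<open>c\<close>, a late index with the Solovay property satisfies
    \<open>m' i > C * m i\<close>. The inequality is strict because \<open>m i\<close>, and
    therefore \<open>r i\<close>, is positive.\<close>
  obtain c where c: "C / \<epsilon> < 2 ^ c" using real_arch_pow[of 2 "C / \<epsilon>"] by auto
  obtain I where I: "\<And>i. i \<ge> I \<Longrightarrow> 2 ^ c * real_of_rat (r i) \<le> m' i" using large by blast
  obtain i where i: "i \<ge> I" "real_of_rat (r i) \<ge> \<epsilon> * m i"
    using \<epsilon>(2) unfolding infinite_nat_iff_unbounded_le by blast
  have "m i > 0" by (rule universal_semimeasure_pos[OF m])
  with \<epsilon>(1) i(2) have "real_of_rat (r i) > 0" by (meson less_le_trans mult_pos_pos)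
  have "C * m i = C / \<epsilon> * (\<epsilon> * m i)" using \<epsilon>(1) by simp
  also have "\<dots> \<le> C / \<epsilon> * real_of_rat (r i)" using i(2) C(1) \<epsilon>(1) by (intro mult_left_mono) auto
  also have "\<dots> < 2 ^ c * real_of_rat (r i)" by (rule mult_strict_right_mono) fact+
  also have "\<dots> \<le> m' i" by (rule I[OF i(1)])
  also have "\<dots> \<le> C * m i" by (rule C(2))
  finally show False by simp
qed

end

theorem theorem13:
  fixes r :: "nat \<Rightarrow> rat"
    and a :: "nat \<Rightarrow> real"
    and \<alpha> :: real
    and m :: "nat \<Rightarrow> real"
    and U :: "bool list \<Rightarrow> nat option"
  assumes "universal_semimeasure m"
    and "optimal_machine U"
    and "computable_rat_seq r"
    and "\<And>i. r i \<ge> 0"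
    and "(\<lambda>i. real_of_rat (r i)) sums \<alpha>"
    and "\<And>n. a n = (\<Sum>i<n. real_of_rat (r i))"
  shows "(solovay_property m r \<longleftrightarrow> martin_loef_random \<alpha>) \<and>
         (martin_loef_random \<alpha> \<longleftrightarrow>
            (\<exists>c::int. \<forall>k::nat. int (modulus a \<alpha> (1 / 2 ^ k)) > BP U (int k - c)))"
proof -
  interpret computable_series r a \<alpha>
    using assms(3-6) by unfold_locales (simp_all only: computable_rat_seq_iff)
  have "semimeasure m" "lower_semicomputable m"
    using assms(1) unfolding universal_semimeasure_def by auto
  then show ?thesis
    using solovay_imp_random[OF assms(1)] random_imp_modulus_gt_BP[OF assms(2)]
      modulus_gt_BP_imp_solovay[OF assms(2)] by blast
qed

end
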